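(* Let $n\ge1$ and let $(B_n,S)$ be the Coxeter system of type $B_n$ with generators $S=\{s_0,s_1,\dots,s_{n-1}\}$, where $s_0s_1$ has order $4$, $s_is_{i+1}$ has order $3$ for $1\le i\le n-2$, and all other pairs of distinct generators commute. Let $w$ be the maximal element (in Bruhat order) of the set $B_n^{S\setminus\{s_0\}}$ of minimal left coset representatives of $B_n$ modulo the parabolic subgroup generated by $S\setminus\{s_0\}$. Then the Poincaré polynomial of the Bruhat interval $[\mathrm{id},w]$ is \[P_{[\mathrm{id},w]}(q)=q^{\binom{n+1}{2}}\sum_{i=0}^{n}S_{n+1,i+1}(1/q)\,[i]!_q.\]
   Context: $P_{[u,w]}(q)=\sum_{v\in[u,w]}q^{\ell(v)}$ where $\ell$ is the Coxeter length and the interval is in Bruhat order. $[x]_q=1+q+\dots+q^{x-1}$ and $[i]!_q=[1]_q\cdots[i]_q$ (with $[0]!_q=1$). The $q$-Stirling numbers $S_{n,k}(q)$ are defined by $S_{0,0}(q)=1$, $S_{n,k}(q)=0$ for $k<0$ or $k>n$, and $S_{n+1,k}(q)=q^{k-1}S_{n,k-1}(q)+[k]_qS_{n,k}(q)$. *)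

theory Defs
  imports "HOL-Algebra.Generated_Groups" "HOL-Algebra.Coset"
begin

definition list_mult :: "('a, 'm) monoid_scheme \<Rightarrow> 'a list \<Rightarrow> 'a" where
  "list_mult G xs = foldr (\<otimes>\<^bsub>G\<^esub>) xs \<one>\<^bsub>G\<^esub>"

text \<open>The value \<open>0\<close> in a Coxeter matrix encodes \<open>\<infinity>\<close>, i.e. the absence of a relation.\<close>

definition coxeter_matrix :: "'i set \<Rightarrow> ('i \<Rightarrow> 'i \<Rightarrow> nat) \<Rightarrow> bool" where
  "coxeter_matrix I m \<longleftrightarrow>
     (\<forall>i\<in>I. m i i = 1) \<and> (\<forall>i\<in>I. \<forall>j\<in>I. m i j = m j i \<and> (i \<noteq> j \<longrightarrow> m i j \<noteq> 1))"

text \<open>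
  The congruence on words generated by \<open>(ij)\<^sup>m\<^sup>(\<^sup>i\<^sup>,\<^sup>j\<^sup>) = 1\<close>. As \<open>m i i = 1\<close> gives \<open>ii = 1\<close>,
  every letter is its own inverse, so words without inverse letters suffice and
  this monoid presentation is the usual group presentation of a Coxeter group.
\<close>

inductive coxeter_eq :: "'i set \<Rightarrow> ('i \<Rightarrow> 'i \<Rightarrow> nat) \<Rightarrow> 'i list \<Rightarrow> 'i list \<Rightarrow> bool"
  for I m where
  rel: "\<lbrakk>i \<in> I; j \<in> I; m i j \<noteq> 0\<rbrakk>
    \<Longrightarrow> coxeter_eq I m (xs @ concat (replicate (m i j) [i, j]) @ ys) (xs @ ys)"
| refl: "coxeter_eq I m xs xs"
| sym: "coxeter_eq I m xs ys \<Longrightarrow> coxeter_eq I m ys xs"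
| trans: "\<lbrakk>coxeter_eq I m xs ys; coxeter_eq I m ys zs\<rbrakk> \<Longrightarrow> coxeter_eq I m xs zs"

text \<open>
  \<open>G\<close> has the presentation with generators \<open>s i\<close> (\<open>i \<in> I\<close>) and relations
  \<open>(s i s j)\<^sup>m\<^sup>(\<^sup>i\<^sup>,\<^sup>j\<^sup>) = 1\<close>.
\<close>

definition coxeter_system ::
  "('a, 'm) monoid_scheme \<Rightarrow> 'i set \<Rightarrow> ('i \<Rightarrow> 'a) \<Rightarrow> ('i \<Rightarrow> 'i \<Rightarrow> nat) \<Rightarrow> bool" where
  "coxeter_system G I s m \<longleftrightarrow>
     group G \<and> coxeter_matrix I m \<and> s ` I \<subseteq> carrier G \<and> generate G (s ` I) = carrier G \<and>
     (\<forall>xs\<in>lists I. \<forall>ys\<in>lists I.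
        list_mult G (map s xs) = list_mult G (map s ys) \<longleftrightarrow> coxeter_eq I m xs ys)"

definition type_B_matrix :: "nat \<Rightarrow> nat \<Rightarrow> nat" where
  "type_B_matrix i j =
     (if i = j then 1
      else if {i, j} = {0, 1} then 4
      else if i = Suc j \<or> j = Suc i then 3
      else 2)"

definition coxeter_length :: "('a, 'm) monoid_scheme \<Rightarrow> 'a set \<Rightarrow> 'a \<Rightarrow> nat" where
  "coxeter_length G S w = (LEAST k. \<exists>xs\<in>lists S. length xs = k \<and> list_mult G xs = w)"

definition reflections :: "('a, 'm) monoid_scheme \<Rightarrow> 'a set \<Rightarrow> 'a set" where
  "reflections G S = {x \<otimes>\<^bsub>G\<^esub> s \<otimes>\<^bsub>G\<^esub> inv\<^bsub>G\<^esub> x | x s. x \<in> carrier G \<and> s \<in> S}"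

definition bruhat_step :: "('a, 'm) monoid_scheme \<Rightarrow> 'a set \<Rightarrow> 'a \<Rightarrow> 'a \<Rightarrow> bool" where
  "bruhat_step G S u w \<longleftrightarrow> u \<in> carrier G \<and> w \<in> carrier G \<and>
     (\<exists>t\<in>reflections G S. w = u \<otimes>\<^bsub>G\<^esub> t) \<and> coxeter_length G S u < coxeter_length G S w"

definition bruhat_le :: "('a, 'm) monoid_scheme \<Rightarrow> 'a set \<Rightarrow> 'a \<Rightarrow> 'a \<Rightarrow> bool" where
  "bruhat_le G S = (bruhat_step G S)\<^sup>*\<^sup>*"

definition bruhat_interval :: "('a, 'm) monoid_scheme \<Rightarrow> 'a set \<Rightarrow> 'a \<Rightarrow> 'a \<Rightarrow> 'a set" where
  "bruhat_interval G S u w = {v \<in> carrier G. bruhat_le G S u v \<and> bruhat_le G S v w}"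

text \<open>The set \<open>W\<^sup>J\<close> of elements of minimal length in their left coset \<open>w W\<^sub>J\<close>.\<close>

definition min_left_coset_reps :: "('a, 'm) monoid_scheme \<Rightarrow> 'a set \<Rightarrow> 'a set \<Rightarrow> 'a set" where
  "min_left_coset_reps G S J =
     {w \<in> carrier G. \<forall>x \<in> w <#\<^bsub>G\<^esub> generate G J. coxeter_length G S w \<le> coxeter_length G S x}"

definition bruhat_maximal_in :: "('a, 'm) monoid_scheme \<Rightarrow> 'a set \<Rightarrow> 'a set \<Rightarrow> 'a \<Rightarrow> bool" where
  "bruhat_maximal_in G S A w \<longleftrightarrow> w \<in> A \<and> (\<forall>x\<in>A. bruhat_le G S w x \<longrightarrow> x = w)"

text \<open>
  The polynomials below are given by their values at an element \<open>q\<close> of an arbitrary commutative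
  ring; taking \<open>q\<close> to be an indeterminate yields the formal polynomials.
\<close>

definition poincare ::
  "('a, 'm) monoid_scheme \<Rightarrow> 'a set \<Rightarrow> 'a \<Rightarrow> 'a \<Rightarrow> 'b::comm_ring_1 \<Rightarrow> 'b" where
  "poincare G S u w q = (\<Sum>v\<in>bruhat_interval G S u w. q ^ coxeter_length G S v)"

definition q_int :: "'b::comm_ring_1 \<Rightarrow> nat \<Rightarrow> 'b" where
  "q_int q x = (\<Sum>i<x. q ^ i)"

definition q_fact :: "'b::comm_ring_1 \<Rightarrow> nat \<Rightarrow> 'b" where
  "q_fact q i = (\<Prod>j=1..i. q_int q j)"

text \<open>
  The recurrence \<open>S\<^sub>n\<^sub>+\<^sub>1\<^sub>,\<^sub>k = q\<^sup>k\<^sup>-\<^sup>1 S\<^sub>n\<^sub>,\<^sub>k\<^sub>-\<^sub>1 + [k] S\<^sub>n\<^sub>,\<^sub>k\<close> at \<open>k = 0\<close> reads \<open>S\<^sub>n\<^sub>+\<^sub>1\<^sub>,\<^sub>0 = 0\<close>, because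
  \<open>S\<^sub>n\<^sub>,\<^sub>-\<^sub>1 = 0\<close> and \<open>[0] = 0\<close>; the vanishing for \<open>k > n\<close> follows from the equations.
\<close>

fun q_stirling :: "'b::comm_ring_1 \<Rightarrow> nat \<Rightarrow> nat \<Rightarrow> 'b" where
  "q_stirling q 0 0 = 1"
| "q_stirling q 0 (Suc k) = 0"
| "q_stirling q (Suc n) 0 = 0"
| "q_stirling q (Suc n) (Suc k) = q ^ k * q_stirling q n k + q_int q (Suc k) * q_stirling q n (Suc k)"

end

theory Submission
  imports Defs
begin

text \<open>
  The group is realised as the signed permutations of \<open>\<plusminus>1, \<dots>, \<plusminus>n\<close>, the length of \<open>v\<close> being the
  number of inversions of the window \<open>v 1, \<dots>, v n\<close> plus the sum of the absolute values of its negative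
  entries. The maximal minimal coset representative is \<open>w i = i - n - 1\<close>, and \<open>[id, w]\<close> consists of
  the \<open>v\<close> with \<open>v i \<ge> i - n - 1\<close> for \<open>1 \<le> i \<le> n\<close>: the negative entries form a placement of
  non-attacking rooks on a staircase board, which accounts for the \<open>q\<close>-Stirling numbers, and the \<open>i\<close>
  positive entries fill the remaining places arbitrarily, which accounts for \<open>[i]!\<close>. Splitting off
  \<open>v 1\<close> turns the sum over all \<open>v\<close> with \<open>k\<close> negative entries into the recurrence of the
  \<open>q\<close>-Stirling numbers.
\<close>

section \<open>Counting staircase windows\<close>

text \<open>The group is given only by a presentation, so lengths and Bruhat order can be computed
  in windows only after no further relation is seen to hold among signed permutations. This is shown
  without counting the group: a word in letters up to \<open>m\<close> is rewritten as a word in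
  letters below \<open>m\<close> followed by a coset word, and only the empty coset word fixes
  \<open>m + 1\<close>.

  The interval is found by two moves. The bound \<open>i - n - 1\<close> grows with
  \<open>i\<close>, so undoing an inversion by a reflection respects it; conversely every dominated
  element other than the top one admits a length-increasing reflection that keeps it dominated. A
  direct description of Bruhat order is thus avoided.

  The argument \<open>1 / q\<close> enters because the count produces \<open>[i+1]\<close> in
  \<open>q\<close> with no power of \<open>q\<close> on the neighbouring Stirling term, while the
  Stirling recurrence carries \<open>q^i\<close> there; evaluating at \<open>1 / q\<close> and
  multiplying by \<open>q^i\<close> reconciles them. Passing from \<open>m\<close> to
  \<open>m + 1\<close> yields \<open>q^(m+1-i)\<close> from the negative entries and
  \<open>q^i\<close> from this reversal, together \<open>q^(m+1)\<close>, and these powers add up to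
  the binomial exponent.\<close>

fun signed_length :: "int list \<Rightarrow> nat" where
  "signed_length [] = 0"
| "signed_length (x # xs) = length (filter (\<lambda>y. y < x) xs) + nat (- x) + signed_length xs"

text \<open>The bound counts the places from an entry to the end, so at position \<open>i\<close> of
  a window of length \<open>n\<close> it is \<open>i - n - 1\<close>. Counting from the right makes
  every tail satisfy the same condition.\<close>

fun staircase :: "int list \<Rightarrow> bool" where
  "staircase [] \<longleftrightarrow> True"
| "staircase (x # xs) \<longleftrightarrow> - int (Suc (length xs)) \<le> x \<and> staircase xs"

text \<open>An arbitrary set of absolute values is allowed because splitting off the head leaves a
  gap in \<open>{1..n}\<close>.\<close>

definition signed_lists :: "int set \<Rightarrow> int list set" where
  "signed_lists A = {xs. distinct (map abs xs) \<and> abs ` set xs = A \<and> staircase xs}"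

definition negs :: "int list \<Rightarrow> int set" where
  "negs xs = {a. 0 < a \<and> - a \<in> set xs}"

lemma length_signed_lists: "xs \<in> signed_lists A \<Longrightarrow> length xs = card A"
  unfolding signed_lists_def
  by (metis (mono_tags, lifting) distinct_card length_map list.set_map mem_Collect_eq)

lemma finite_signed_lists: "finite A \<Longrightarrow> finite (signed_lists A)"
proof (rule finite_subset)
  show "signed_lists A \<subseteq> {xs. set xs \<subseteq> A \<union> uminus ` A \<and> length xs = card A}"
  proof safe
    fix xs x assume xs: "xs \<in> signed_lists A" and "x \<in> set xs" "x \<notin> uminus ` A"
    then have "\<bar>x\<bar> \<in> A" by (auto simp: signed_lists_def)
    moreover have "\<bar>x\<bar> \<noteq> - x" using \<open>x \<notin> uminus ` A\<close> calculation by force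
    ultimately show "x \<in> A" by (auto simp: abs_if split: if_splits)
  qed (auto simp: length_signed_lists)
qed (auto intro: finite_lists_length_eq)

lemma negs_subset: "xs \<in> signed_lists A \<Longrightarrow> negs xs \<subseteq> A"
  by (force simp: signed_lists_def negs_def)

lemma set_signed_list:
  assumes xs: "xs \<in> signed_lists A" and pos: "A \<subseteq> {0<..}"
  shows "set xs = uminus ` negs xs \<union> (A - negs xs)"
proof -
  have "x \<in> A" if "x \<in> set xs" "x > 0" for x
    using that xs by (force simp: signed_lists_def)
  moreover have "x \<noteq> 0" if "x \<in> set xs" for x
    using that xs pos by (force simp: signed_lists_def)
  moreover have "- x \<notin> set xs" if "x \<in> set xs" "x > 0" for x
  proof
    assume "- x \<in> set xs"
    moreover have "inj_on abs (set xs)"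
      using xs by (auto simp: signed_lists_def distinct_map)
    ultimately have "- x = x" using that(1) by (auto dest: inj_onD[of abs _ "- x" x])
    then show False using that by simp
  qed
  moreover have "a \<in> set xs \<or> - a \<in> set xs" if "a \<in> A" for a
  proof -
    have "a \<in> abs ` set xs" using that xs by (simp add: signed_lists_def)
    then obtain y where "y \<in> set xs" "a = \<bar>y\<bar>" by blast
    then show ?thesis by (auto simp: abs_if split: if_splits)
  qed
  ultimately show ?thesis
    using pos unfolding negs_def set_eq_iff
    by (simp add: image_iff subset_iff) (metis (no_types) equation_minus_iff linorder_neqE neg_0_less_iff_less)
qed

text \<open>The absolute values are distinct and exhaust \<open>A\<close>, so the whole list has
  length \<open>card A\<close> and the bound on the head no longer refers to the tail.\<close>

lemma Cons_in_signed_lists: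
  assumes "finite A" "a \<in> A" "\<bar>x\<bar> = a"
  shows "x # xs \<in> signed_lists A \<longleftrightarrow> xs \<in> signed_lists (A - {a}) \<and> - int (card A) \<le> x"
proof -
  have *: "distinct (map abs (x # xs)) \<and> abs ` set (x # xs) = A \<longleftrightarrow>
      distinct (map abs xs) \<and> abs ` set xs = A - {a}"
    using assms(2,3) by (auto simp: image_iff)
  have "Suc (length xs) = card A" if "distinct (map abs xs)" "abs ` set xs = A - {a}"
  proof -
    have "length xs = card (A - {a})" using that by (metis distinct_card length_map list.set_map)
    then show ?thesis using assms(1,2) by (metis card.remove)
  qed
  moreover have "x # xs \<in> signed_lists A \<longleftrightarrow>
      (distinct (map abs xs) \<and> abs ` set xs = A - {a}) \<and> - int (Suc (length xs)) \<le> x \<and> staircase xs"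
    unfolding signed_lists_def mem_Collect_eq *[symmetric] by (simp del: of_nat_Suc)
  ultimately show ?thesis
    unfolding signed_lists_def[of "A - {a}"] mem_Collect_eq by (metis (no_types))
qed

text \<open>Case split on the sign of the head: a positive head meets the staircase bound
  automatically, a negative head \<open>- a\<close> exactly when \<open>a\<close> is at most
  \<open>card A\<close>.\<close>

lemma signed_lists_decomp:
  assumes "finite A" "A \<noteq> {}" "A \<subseteq> {0<..}" "N \<subseteq> A"
  shows "{xs \<in> signed_lists A. negs xs = N} =
    (\<Union>a\<in>A - N. (#) a ` {xs \<in> signed_lists (A - {a}). negs xs = N}) \<union>
    (\<Union>a\<in>{a \<in> N. a \<le> int (card A)}.
       (#) (- a) ` {xs \<in> signed_lists (A - {a}). negs xs = N - {a}})" (is "?L = ?R1 \<union> ?R2")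
proof (intro equalityI subsetI)
  fix ys assume ys: "ys \<in> ?L"
  then have "ys \<noteq> []" using assms(2) by (auto simp: signed_lists_def)
  then obtain x xs where eq: "ys = x # xs" by (cases ys) auto
  have mem: "\<bar>x\<bar> \<in> A" using ys eq by (auto simp: signed_lists_def)
  then have "x \<noteq> 0" using assms(3) by auto
  have xs: "xs \<in> signed_lists (A - {\<bar>x\<bar>})" "- int (card A) \<le> x"
    using Cons_in_signed_lists[OF assms(1) mem HOL.refl] ys eq by auto
  then have nm: "\<bar>x\<bar> \<notin> negs xs" using negs_subset by blast
  show "ys \<in> ?R1 \<union> ?R2"
  proof (cases "x > 0")
    case True
    then have "negs xs = N" using ys eq by (auto simp: negs_def)
    then have "ys \<in> ?R1" using True xs nm mem eq by auto
    then show ?thesis ..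
  next
    case False
    then have neg: "x < 0" using \<open>x \<noteq> 0\<close> by simp
    then have "negs ys = insert (- x) (negs xs)" by (auto simp: negs_def eq)
    then have "N = insert (- x) (negs xs)" using ys by simp
    then have "negs xs = N - {- x}" "- x \<in> N" using nm neg by auto
    then have "ys \<in> ?R2" using xs neg eq by (intro UN_I[of "- x"]) auto
    then show ?thesis ..
  qed
next
  fix ys assume "ys \<in> ?R1 \<union> ?R2"
  then show "ys \<in> ?L"
  proof
    assume "ys \<in> ?R1"
    then obtain a xs where a: "a \<in> A - N" "xs \<in> signed_lists (A - {a})" "negs xs = N" "ys = a # xs"
      by auto
    then have "a > 0" using assms(3) by auto
    then have "ys \<in> signed_lists A" using Cons_in_signed_lists[of A a a xs] a assms(1) by auto
    moreover have "negs ys = N" using a \<open>a > 0\<close> by (auto simp: negs_def)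
    ultimately show ?thesis by simp
  next
    assume "ys \<in> ?R2"
    then obtain a xs where a: "a \<in> N" "a \<le> int (card A)" "xs \<in> signed_lists (A - {a})"
      "negs xs = N - {a}" "ys = - a # xs"
      by auto
    then have "a > 0" using assms(3,4) by auto
    then have "ys \<in> signed_lists A"
      using Cons_in_signed_lists[of A a "- a" xs] a assms(1,4) by auto
    moreover have "negs ys = insert a (negs xs)" using a \<open>a > 0\<close> by (auto simp: negs_def)
    ultimately show ?thesis using a by auto
  qed
qed

lemma length_filter_signed:
  assumes "xs \<in> signed_lists A"
  shows "length (filter P xs) = card {x \<in> set xs. P x}"
proof -
  have "distinct xs" using assms by (auto simp: signed_lists_def distinct_map)
  then show ?thesis by (metis distinct_card distinct_filter set_filter)
qed

text \<open>Every element of \<open>N\<close> occurs negated in the tail and lies below the positive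
  head; of the positive entries only the smaller ones count.\<close>

lemma signed_length_Cons_pos:
  assumes "finite A" "A \<subseteq> {0<..}" "a \<in> A" "xs \<in> signed_lists (A - {a})" "negs xs = N"
  shows "signed_length (a # xs) = card N + card {c \<in> A - N. c < a} + signed_length xs"
proof -
  have pos: "a > 0" using assms by auto
  have N: "N \<subseteq> A - {a}" "finite N"
    using negs_subset[OF assms(4)] assms(1,5) by (auto intro: finite_subset)
  have "{x \<in> set xs. x < a} = uminus ` N \<union> {c \<in> A - N. c < a}"
    using set_signed_list[OF assms(4)] assms(2,5) pos N by auto
  moreover have "uminus ` N \<inter> {c \<in> A - N. c < a} = {}"
  proof -
    have "b \<notin> A" if "b \<in> uminus ` N" for b
      using that N assms(2) by (auto simp: image_iff subset_iff) (metis neg_0_less_iff_less not_less_iff_gr_or_eq)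
    then show ?thesis by blast
  qed
  ultimately have "card {x \<in> set xs. x < a} = card (uminus ` N) + card {c \<in> A - N. c < a}"
    using N assms(1) by (simp add: card_Un_disjoint)
  also have "card (uminus ` N) = card N" by (simp add: card_image)
  finally show ?thesis using pos length_filter_signed[OF assms(4)] by simp
qed

text \<open>Below \<open>- a\<close> lie only the entries \<open>- b\<close> with \<open>b\<close>
  in \<open>N\<close> larger than \<open>a\<close>; the summand \<open>nat a\<close> is the head's
  own contribution.\<close>

lemma signed_length_Cons_neg:
  assumes "finite A" "A \<subseteq> {0<..}" "a \<in> A" "xs \<in> signed_lists (A - {a})" "negs xs = N"
  shows "signed_length (- a # xs) = nat a + card {b \<in> N. a < b} + signed_length xs"
proof -
  have pos: "a > 0" using assms by auto
  have "{x \<in> set xs. x < - a} = uminus ` {b \<in> N. a < b}"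
    using set_signed_list[OF assms(4)] assms(2,5) pos by force
  then have "card {x \<in> set xs. x < - a} = card {b \<in> N. a < b}" by (simp add: card_image)
  then show ?thesis using pos length_filter_signed[OF assms(4)] by simp
qed

section \<open>Weights of prescribed negative sets and their recurrence\<close>

lemma q_int_0 [simp]: "q_int q 0 = 0"
  by (simp add: q_int_def)

lemma q_int_Suc: "q_int q (Suc n) = q_int q n + q ^ n"
  by (simp add: q_int_def)

text \<open>The rank of an element within \<open>C\<close> takes each value below
  \<open>card C\<close> exactly once.\<close>

lemma sum_power_rank:
  fixes C :: "int set"
  assumes "finite C"
  shows "(\<Sum>a\<in>C. q ^ card {c \<in> C. c < a}) = q_int q (card C)"
  using assms
proof (induction C rule: finite_linorder_max_induct)
  case (insert b C)
  have "(\<Sum>a\<in>C. q ^ card {c \<in> insert b C. c < a}) = (\<Sum>a\<in>C. q ^ card {c \<in> C. c < a})"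
    using insert.hyps by (intro sum.cong HOL.refl arg_cong[of _ _ "\<lambda>x. q ^ card x"]) auto
  moreover have "{c \<in> insert b C. c < b} = C" using insert.hyps by auto
  ultimately show ?case using insert by (auto simp: q_int_Suc add.commute)
qed simp

text \<open>
  The contribution of the lists with a prescribed set \<open>N\<close> of absolute values of negative entries; it
  depends on the set of all absolute values only through its cardinality \<open>m\<close>, since relabelling the
  positive entries in an order-preserving way does not change the length.
\<close>

fun neg_weight :: "'b::comm_ring_1 \<Rightarrow> nat \<Rightarrow> int set \<Rightarrow> 'b" where
  "neg_weight q 0 N = (if N = {} then 1 else 0)"
| "neg_weight q (Suc m) N = q ^ card N * q_int q (Suc m - card N) * neg_weight q m N +
    (\<Sum>a\<in>{a \<in> N. a \<le> int (Suc m)}. q ^ (nat a + card {b \<in> N. a < b}) * neg_weight q m (N - {a}))"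

text \<open>A positive head runs through \<open>A - N\<close> and contributes its rank there, so its
  sum is a \<open>q\<close>-integer in \<open>card A - card N\<close>; this is the step at which
  only the size of \<open>A\<close> survives.\<close>

lemma sum_signed_lists_negs:
  fixes q :: "'b::comm_ring_1"
  assumes "finite A" "A \<subseteq> {0<..}" "card A = m" "N \<subseteq> A"
  shows "(\<Sum>xs | xs \<in> signed_lists A \<and> negs xs = N. q ^ signed_length xs) = neg_weight q m N"
  using assms
proof (induction m arbitrary: A N)
  case 0
  then have "A = {}" "N = {}" by auto
  then have "{xs \<in> signed_lists A. negs xs = N} = {[]}"
    by (auto simp: signed_lists_def negs_def)
  then show ?case using \<open>N = {}\<close> by simp
next
  case (Suc m)
  let ?F = "\<lambda>A N. {xs \<in> signed_lists A. negs xs = N}"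
  let ?f = "\<lambda>xs. q ^ signed_length xs"
  have fin: "finite (?F B M)" if "finite B" for B M
    using finite_signed_lists[OF that] by simp
  have fA: "finite A" "finite N" using Suc.prems by (auto intro: finite_subset)
  let ?N = "{a \<in> N. a \<le> int (card A)}"
  have "A \<noteq> {}" using Suc.prems by auto
  have posA: "\<And>a. a \<in> A \<Longrightarrow> a > 0" using Suc.prems by auto
  have decomp: "?F A N = (\<Union>a\<in>A - N. (#) a ` ?F (A - {a}) N) \<union>
    (\<Union>a\<in>?N. (#) (- a) ` ?F (A - {a}) (N - {a}))"
    using Suc.prems \<open>A \<noteq> {}\<close> by (intro signed_lists_decomp) auto
  have disj: "(\<Union>a\<in>A - N. (#) a ` ?F (A - {a}) N) \<inter>
    (\<Union>a\<in>?N. (#) (- a) ` ?F (A - {a}) (N - {a})) = {}"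
    using posA Suc.prems(4) by force
  have 1: "sum ?f (\<Union>a\<in>A - N. (#) a ` ?F (A - {a}) N) =
      q ^ card N * q_int q (Suc m - card N) * neg_weight q m N"
  proof -
    have "sum ?f (\<Union>a\<in>A - N. (#) a ` ?F (A - {a}) N) =
        (\<Sum>a\<in>A - N. sum ?f ((#) a ` ?F (A - {a}) N))"
      using fA fin by (intro sum.UNION_disjoint) auto
    also have "\<dots> = (\<Sum>a\<in>A - N. q ^ card N * q ^ card {c \<in> A - N. c < a} * neg_weight q m N)"
    proof (intro sum.cong HOL.refl)
      fix a assume a: "a \<in> A - N"
      have "sum ?f ((#) a ` ?F (A - {a}) N) = (\<Sum>xs\<in>?F (A - {a}) N. ?f (a # xs))"
        by (subst sum.reindex) (auto simp: inj_on_def)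
      also have "\<dots> = (\<Sum>xs\<in>?F (A - {a}) N. q ^ card N * q ^ card {c \<in> A - N. c < a} * ?f xs)"
        using signed_length_Cons_pos[OF fA(1) Suc.prems(2), of a _ N] a
        by (intro sum.cong HOL.refl) (auto simp: power_add simp del: signed_length.simps)
      also have "\<dots> = q ^ card N * q ^ card {c \<in> A - N. c < a} * neg_weight q m N"
        using Suc.prems a by (subst Suc.IH[of "A - {a}" N, symmetric])
          (auto simp: sum_distrib_left)
      finally show "sum ?f ((#) a ` ?F (A - {a}) N) = \<dots>" .
    qed
    also have "\<dots> = q ^ card N * (\<Sum>a\<in>A - N. q ^ card {c \<in> A - N. c < a}) * neg_weight q m N"
      by (simp add: sum_distrib_left sum_distrib_right)
    finally show ?thesis
      using Suc.prems fA by (simp only: sum_power_rank finite_Diff card_Diff_subset)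
  qed
  have 2: "sum ?f (\<Union>a\<in>?N. (#) (- a) ` ?F (A - {a}) (N - {a})) =
      (\<Sum>a\<in>?N. q ^ (nat a + card {b \<in> N. a < b}) * neg_weight q m (N - {a}))"
  proof -
    have "sum ?f (\<Union>a\<in>?N. (#) (- a) ` ?F (A - {a}) (N - {a})) =
        (\<Sum>a\<in>?N. sum ?f ((#) (- a) ` ?F (A - {a}) (N - {a})))"
      using fA fin by (intro sum.UNION_disjoint) auto
    also have "\<dots> = (\<Sum>a\<in>?N. q ^ (nat a + card {b \<in> N. a < b}) * neg_weight q m (N - {a}))"
    proof (intro sum.cong HOL.refl)
      fix a assume a: "a \<in> ?N"
      have eq: "{b \<in> N. b \<noteq> a \<and> a < b} = {b \<in> N. a < b}" by auto
      have "sum ?f ((#) (- a) ` ?F (A - {a}) (N - {a})) =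
          (\<Sum>xs\<in>?F (A - {a}) (N - {a}). ?f (- a # xs))"
        by (subst sum.reindex) (auto simp: inj_on_def)
      also have "\<dots> = (\<Sum>xs\<in>?F (A - {a}) (N - {a}). q ^ (nat a + card {b \<in> N. a < b}) * ?f xs)"
        using signed_length_Cons_neg[OF fA(1) Suc.prems(2), of a _ "N - {a}"] a Suc.prems(4)
        by (intro sum.cong HOL.refl) (auto simp: power_add eq simp del: signed_length.simps)
      also have "\<dots> = q ^ (nat a + card {b \<in> N. a < b}) * neg_weight q m (N - {a})"
        using Suc.prems a by (subst Suc.IH[of "A - {a}" "N - {a}", symmetric])
          (auto simp: sum_distrib_left)
      finally show "sum ?f ((#) (- a) ` ?F (A - {a}) (N - {a})) = \<dots>" .
    qed
    finally show ?thesis .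
  qed
  have "sum ?f (?F A N) = sum ?f (\<Union>a\<in>A - N. (#) a ` ?F (A - {a}) N) +
      sum ?f (\<Union>a\<in>?N. (#) (- a) ` ?F (A - {a}) (N - {a}))"
    unfolding decomp using fA fin disj by (intro sum.union_disjoint) auto
  then show ?case using 1 2 Suc.prems(3) by simp
qed

text \<open>An entry \<open>- b\<close> needs at least \<open>b\<close> places from its position to
  the end. In the recurrence such a \<open>b\<close> is never the one removed, so it is still
  present at \<open>m = 0\<close>, where a nonempty set has weight 0.\<close>

lemma neg_weight_eq_0:
  assumes "finite N" "b \<in> N" "int m < b"
  shows "neg_weight q m N = 0"
  using assms
proof (induction m arbitrary: N)
  case (Suc m)
  have "neg_weight q m (N - {a}) = 0" if "a \<le> int (Suc m)" for a
    using Suc.prems that by (intro Suc.IH) auto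
  moreover have "neg_weight q m N = 0" using Suc.prems by (intro Suc.IH) auto
  ultimately show ?case by simp
qed auto

definition neg_total :: "'b::comm_ring_1 \<Rightarrow> nat \<Rightarrow> nat \<Rightarrow> 'b" where
  "neg_total q m k = (\<Sum>N | N \<subseteq> {1..int m} \<and> card N = k. neg_weight q m N)"

text \<open>Sets that contain \<open>m + 1\<close> have weight 0. The larger range is the one that
  arises when the recurrence is unfolded at \<open>Suc m\<close>.\<close>

lemma neg_total_alt:
  "neg_total q m k = (\<Sum>N | N \<subseteq> {1..int (Suc m)} \<and> card N = k. neg_weight q m N)"
  unfolding neg_total_def
proof (rule sum.mono_neutral_left)
  show "\<forall>N\<in>{N. N \<subseteq> {1..int (Suc m)} \<and> card N = k} - {N. N \<subseteq> {1..int m} \<and> card N = k}.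
      neg_weight q m N = 0"
  proof
    fix N
    assume "N \<in> {N. N \<subseteq> {1..int (Suc m)} \<and> card N = k} - {N. N \<subseteq> {1..int m} \<and> card N = k}"
    then have N: "N \<subseteq> {1..int (Suc m)}" "\<not> N \<subseteq> {1..int m}" by auto
    then obtain b where "b \<in> N" "int m < b" by force
    then show "neg_weight q m N = 0"
      using neg_weight_eq_0 N(1) finite_subset[OF N(1)] by blast
  qed
qed auto

text \<open>The \<open>a - 1\<close> smaller positive integers split into those in \<open>N\<close>
  and those outside. Hence \<open>a\<close> plus the number of larger elements of \<open>N\<close>
  equals \<open>card N + 1\<close> plus the rank of \<open>a\<close> in the complement, and the
  ranks sum to a \<open>q\<close>-integer.\<close>

lemma sum_insertions:
  fixes q :: "'b::comm_ring_1"
  assumes N: "N \<subseteq> {1..int m}"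
  shows "(\<Sum>a\<in>{1..int (Suc m)} - N. q ^ (nat a + card {b \<in> N. a < b})) =
    q ^ Suc (card N) * q_int q (Suc m - card N)"
proof -
  let ?C = "{1..int (Suc m)} - N"
  have fN: "finite N" using N finite_subset by blast
  have "nat a + card {b \<in> N. a < b} = Suc (card N) + card {c \<in> ?C. c < a}" if "a \<in> ?C" for a
  proof -
    have "{1..<a} = {b \<in> N. b < a} \<union> {c \<in> ?C. c < a}" using N that by auto
    moreover have "card ({b \<in> N. b < a} \<union> {c \<in> ?C. c < a}) =
        card {b \<in> N. b < a} + card {c \<in> ?C. c < a}"
      using fN by (intro card_Un_disjoint finite_subset[of "{c \<in> ?C. c < a}" ?C]) auto
    ultimately have "card {1..<a} = card {b \<in> N. b < a} + card {c \<in> ?C. c < a}" by argo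
    moreover have "card N = card {b \<in> N. b < a} + card {b \<in> N. a < b}"
    proof -
      have "b < a \<or> a < b" if "b \<in> N" for b
        using that \<open>a \<in> ?C\<close> by (cases "b = a") auto
      then have "{b \<in> N. b < a} \<union> {b \<in> N. a < b} = N" by blast
      moreover have "card ({b \<in> N. b < a} \<union> {b \<in> N. a < b}) =
          card {b \<in> N. b < a} + card {b \<in> N. a < b}"
        using fN by (intro card_Un_disjoint) auto
      ultimately show ?thesis by argo
    qed
    moreover have "card {1..<a} + 1 = nat a" using that by auto
    ultimately show ?thesis by linarith
  qed
  then have "(\<Sum>a\<in>?C. q ^ (nat a + card {b \<in> N. a < b})) =
      (\<Sum>a\<in>?C. q ^ Suc (card N) * q ^ card {c \<in> ?C. c < a})"
    by (intro sum.cong HOL.refl) (simp add: power_add)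
  also have "\<dots> = q ^ Suc (card N) * q_int q (card ?C)"
    by (subst sum_power_rank[symmetric]) (auto simp: sum_distrib_left)
  also have "card ?C = Suc m - card N"
    using N fN by (subst card_Diff_subset) auto
  finally show ?thesis .
qed

lemma neg_total_0_0: "neg_total q 0 0 = 1"
proof -
  have "{N. N \<subseteq> {1..int 0} \<and> card N = 0} = {{}}" by auto
  then show ?thesis by (simp add: neg_total_def)
qed

text \<open>For a negative head, the pairs of a set \<open>N\<close> of size \<open>k\<close> and an
  \<open>a\<close> in it are traded for the pairs of \<open>N - {a}\<close> and \<open>a\<close>.
  The weight then depends on the smaller set alone, and the sum over the inserted \<open>a\<close>
  is \<open>sum_insertions\<close>.\<close>

lemma neg_total_Suc:
  fixes q :: "'b::comm_ring_1"
  shows "neg_total q (Suc m) k = q ^ k * q_int q (Suc m - k) * neg_total q m k +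
    (if k = 0 then 0 else q ^ k * q_int q (Suc (Suc m) - k) * neg_total q m (k - 1))"
proof -
  let ?S = "\<lambda>m k. {N. N \<subseteq> {1..int m} \<and> card N = k}"
  let ?w = "\<lambda>a N. q ^ (nat a + card {b \<in> N. a < b})"
  have fS: "finite (?S m k)" for m k by simp
  have fN: "finite N" if "N \<in> ?S m k" for N m k
    using that by (auto intro: finite_subset)
  have "neg_total q (Suc m) k =
      (\<Sum>N\<in>?S (Suc m) k. q ^ k * q_int q (Suc m - k) * neg_weight q m N) +
      (\<Sum>N\<in>?S (Suc m) k. \<Sum>a\<in>N. ?w a N * neg_weight q m (N - {a}))"
    unfolding neg_total_def sum.distrib[symmetric]
  proof (intro sum.cong HOL.refl)
    fix N assume N: "N \<in> ?S (Suc m) k"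
    then have "{a \<in> N. a \<le> int (Suc m)} = N" by auto
    then show "neg_weight q (Suc m) N = q ^ k * q_int q (Suc m - k) * neg_weight q m N +
        (\<Sum>a\<in>N. ?w a N * neg_weight q m (N - {a}))"
      using N by simp
  qed
  also have "(\<Sum>N\<in>?S (Suc m) k. q ^ k * q_int q (Suc m - k) * neg_weight q m N) =
      q ^ k * q_int q (Suc m - k) * neg_total q m k"
    by (simp add: neg_total_alt sum_distrib_left)
  also have "(\<Sum>N\<in>?S (Suc m) k. \<Sum>a\<in>N. ?w a N * neg_weight q m (N - {a})) =
      (if k = 0 then 0 else q ^ k * q_int q (Suc (Suc m) - k) * neg_total q m (k - 1))"
  proof (cases k)
    case 0
    then have "N = {}" if "N \<in> ?S (Suc m) k" for N using that fN[OF that] by auto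
    then show ?thesis using 0 by (auto intro!: sum.neutral)
  next
    case (Suc j)
    have "(\<Sum>N\<in>?S (Suc m) k. \<Sum>a\<in>N. ?w a N * neg_weight q m (N - {a})) =
        (\<Sum>(N, a)\<in>Sigma (?S (Suc m) k) (\<lambda>N. N). ?w a N * neg_weight q m (N - {a}))"
      using fS fN by (intro sum.Sigma ballI)
    also have "\<dots> = (\<Sum>(N, a)\<in>Sigma (?S (Suc m) j) (\<lambda>N. {1..int (Suc m)} - N). ?w a N * neg_weight q m N)"
    proof (rule sum.reindex_bij_witness[where i = "\<lambda>(N, a). (insert a N, a)"
          and j = "\<lambda>(N, a). (N - {a}, a)"])
      fix p assume p: "p \<in> Sigma (?S (Suc m) k) (\<lambda>N. N)"
      then obtain N a where pq: "p = (N, a)" "N \<in> ?S (Suc m) k" "a \<in> N" by auto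
      have "{b \<in> N - {a}. a < b} = {b \<in> N. a < b}" by auto
      then show "(case case p of (N, a) \<Rightarrow> (N - {a}, a) of (N, a) \<Rightarrow> ?w a N * neg_weight q m N) =
          (case p of (N, a) \<Rightarrow> ?w a N * neg_weight q m (N - {a}))"
        by (simp add: pq)
      show "(case p of (N, a) \<Rightarrow> (N - {a}, a)) \<in> Sigma (?S (Suc m) j) (\<lambda>N. {1..int (Suc m)} - N)"
        using pq Suc fN[OF pq(2)] by auto
      show "(case case p of (N, a) \<Rightarrow> (N - {a}, a) of (N, a) \<Rightarrow> (insert a N, a)) = p"
        using pq by auto
    next
      fix p assume p: "p \<in> Sigma (?S (Suc m) j) (\<lambda>N. {1..int (Suc m)} - N)"
      then obtain N a where pq: "p = (N, a)" "N \<in> ?S (Suc m) j" "a \<in> {1..int (Suc m)} - N" by auto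
      then show "(case p of (N, a) \<Rightarrow> (insert a N, a)) \<in> Sigma (?S (Suc m) k) (\<lambda>N. N)"
        using Suc fN[OF pq(2)] by auto
      show "(case case p of (N, a) \<Rightarrow> (insert a N, a) of (N, a) \<Rightarrow> (N - {a}, a)) = p"
        using pq by auto
    qed
    also have "\<dots> = (\<Sum>N\<in>?S (Suc m) j. \<Sum>a\<in>{1..int (Suc m)} - N. ?w a N * neg_weight q m N)"
      using fS by (intro sum.Sigma[symmetric] ballI) simp_all
    also have "\<dots> = (\<Sum>N\<in>?S (Suc m) j. q ^ k * q_int q (Suc (Suc m) - k) * neg_weight q m N)"
    proof (intro sum.cong HOL.refl)
      fix N assume N: "N \<in> ?S (Suc m) j"
      show "(\<Sum>a\<in>{1..int (Suc m)} - N. ?w a N * neg_weight q m N) =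
          q ^ k * q_int q (Suc (Suc m) - k) * neg_weight q m N"
      \<comment> \<open>\<open>sum_insertions\<close> needs room for \<open>m + 1\<close> outside
        \<open>N\<close>; the sets that contain \<open>m + 1\<close> have weight 0 on both
        sides.\<close>
      proof (cases "N \<subseteq> {1..int m}")
        case True
        then show ?thesis
          using sum_insertions[OF True, of q] N Suc by (simp add: sum_distrib_right[symmetric])
      next
        case False
        then obtain b where "b \<in> N" "b \<notin> {1..int m}" by blast
        moreover have "1 \<le> b" using N \<open>b \<in> N\<close> by auto
        ultimately have "neg_weight q m N = 0" using fN[OF N] by (intro neg_weight_eq_0[of N b]) auto
        then show ?thesis by simp
      qed
    qed
    also have "\<dots> = q ^ k * q_int q (Suc (Suc m) - k) * neg_total q m j"
      by (simp add: neg_total_alt sum_distrib_left)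
    finally show ?thesis using Suc by simp
  qed
  finally show ?thesis .
qed

section \<open>Comparison with the \<open>q\<close>-Stirling recurrence\<close>

lemma q_stirling_eq_0: "n < k \<Longrightarrow> q_stirling q n k = 0"
proof (induction n arbitrary: k)
  case 0
  then show ?case by (cases k) auto
next
  case (Suc n)
  then show ?case by (cases k) auto
qed

lemma q_fact_Suc: "q_fact q (Suc i) = q_fact q i * q_int q (Suc i)"
  by (simp add: q_fact_def)

text \<open>Reversal of the order of summation; this is the exchange of \<open>q\<close> and
  \<open>1 / q\<close> behind the final formula.\<close>

lemma q_int_inverse:
  fixes q :: "'b::field"
  assumes "q \<noteq> 0"
  shows "q ^ k * q_int (1 / q) (Suc k) = q_int q (Suc k)"
proof -
  have "q_int q (Suc k) = (\<Sum>i<Suc k. q ^ (Suc k - Suc i))"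
    unfolding q_int_def by (rule sum.nat_diff_reindex[symmetric])
  also have "\<dots> = (\<Sum>i<Suc k. q ^ k * (1 / q) ^ i)"
    using assms by (intro sum.cong HOL.refl) (auto simp: power_diff power_one_over field_simps)
  finally show ?thesis by (simp only: q_int_def sum_distrib_left)
qed

lemma choose_two_Suc: "Suc n choose 2 = (n choose 2) + n"
  by (simp add: numeral_2_eq_2)

text \<open>Here \<open>i\<close> is the number of positive entries. Adding a positive head supplies
  the factor \<open>[i]\<close> that turns \<open>[i-1]!\<close> into \<open>[i]!\<close>; adding a
  negative head supplies the factor \<open>[i+1]\<close> of the Stirling recurrence.\<close>

lemma neg_total_eq_q_stirling:
  fixes q :: "'b::field"
  assumes "q \<noteq> 0" "i \<le> m"
  shows "neg_total q m (m - i) = q ^ (Suc m choose 2) * (q_stirling (1 / q) (Suc m) (Suc i) * q_fact q i)"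
  using assms(2)
proof (induction m arbitrary: i)
  case 0
  then show ?case by (simp add: neg_total_0_0 q_fact_def q_int_def numeral_2_eq_2)
next
  case (Suc m)
  let ?c = "Suc m choose 2"
  let ?S = "\<lambda>k. q_stirling (1 / q) (Suc m) k"
  \<comment> \<open>For \<open>i = 0\<close> both sides vanish, the left by \<open>[0] = 0\<close>
    and the right by \<open>S_(m+1,0) = 0\<close>. Otherwise this is the induction hypothesis at
    \<open>i - 1\<close>.\<close>
  have 1: "q_int q i * neg_total q m (Suc m - i) = q ^ ?c * (?S i * q_fact q i)"
  proof (cases i)
    case (Suc j)
    then show ?thesis using Suc.IH[of j] Suc.prems by (simp add: q_fact_Suc mult_ac)
  qed simp
  have 2: "(if Suc m - i = 0 then 0 else neg_total q m (Suc m - i - 1)) = q ^ ?c * (?S (Suc i) * q_fact q i)"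
  proof (cases "i = Suc m")
    case False
    then show ?thesis using Suc.IH[of i] Suc.prems by auto
  next
    case True
    then show ?thesis using q_stirling_eq_0[of "Suc m" "Suc i" "1 / q"] by (simp del: q_stirling.simps)
  qed
  have "Suc m - (Suc m - i) = i" "Suc (Suc m) - (Suc m - i) = Suc i" using Suc.prems by auto
  then have "neg_total q (Suc m) (Suc m - i) = q ^ (Suc m - i) * (q_int q i * neg_total q m (Suc m - i)
      + q_int q (Suc i) * (if Suc m - i = 0 then 0 else neg_total q m (Suc m - i - 1)))"
    by (subst neg_total_Suc) (auto simp: algebra_simps)
  also have "\<dots> = q ^ (Suc m - i) * q ^ ?c * (?S i + q_int q (Suc i) * ?S (Suc i)) * q_fact q i"
    unfolding 1 2 by (simp add: algebra_simps)
  \<comment> \<open>Factoring out \<open>q^i\<close> gives the first term the power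
    \<open>(1 / q)^i\<close> and turns \<open>[i+1]\<close> at \<open>q\<close> into
    \<open>[i+1]\<close> at \<open>1 / q\<close>, which is the recurrence at
    \<open>1 / q\<close>.\<close>
  also have "?S i + q_int q (Suc i) * ?S (Suc i) = q ^ i * q_stirling (1 / q) (Suc (Suc m)) (Suc i)"
    using assms(1) q_int_inverse[OF assms(1), of i, symmetric]
    by (simp add: algebra_simps power_one_over)
  also have "q ^ (Suc m - i) * q ^ ?c * (q ^ i * q_stirling (1 / q) (Suc (Suc m)) (Suc i)) * q_fact q i =
      q ^ (Suc m - i + ?c + i) * (q_stirling (1 / q) (Suc (Suc m)) (Suc i) * q_fact q i)"
    by (simp only: power_add mult_ac)
  also have "Suc m - i + ?c + i = Suc (Suc m) choose 2"
    using Suc.prems choose_two_Suc[of "Suc m"] by simp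
  finally show ?case .
qed

lemma sum_signed_lists:
  fixes q :: "'b::field"
  assumes "q \<noteq> 0"
  shows "(\<Sum>xs\<in>signed_lists {1..int n}. q ^ signed_length xs) =
    q ^ ((n + 1) choose 2) * (\<Sum>i=0..n. q_stirling (1 / q) (n + 1) (i + 1) * q_fact q i)"
proof -
  let ?A = "{1..int n}"
  have "(\<Sum>xs\<in>signed_lists ?A. q ^ signed_length xs) =
      (\<Sum>N\<in>Pow ?A. \<Sum>xs | xs \<in> signed_lists ?A \<and> negs xs = N. q ^ signed_length xs)"
    using negs_subset by (intro sum.group[symmetric] finite_signed_lists) auto
  also have "\<dots> = (\<Sum>N\<in>Pow ?A. neg_weight q n N)"
    by (intro sum.cong HOL.refl sum_signed_lists_negs) auto
  also have "\<dots> = (\<Sum>k\<in>{0..n}. \<Sum>N | N \<in> Pow ?A \<and> card N = k. neg_weight q n N)"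
  proof (intro sum.group[symmetric])
    have "card N \<le> n" if "N \<subseteq> ?A" for N using card_mono[OF _ that] by simp
    then show "card ` Pow ?A \<subseteq> {0..n}" by auto
  qed auto
  also have "\<dots> = (\<Sum>k\<in>{0..n}. neg_total q n k)"
    by (simp add: neg_total_def)
  also have "\<dots> = (\<Sum>i\<in>{0..n}. neg_total q n (n - i))"
    by (rule sum.reindex_bij_witness[where i = "\<lambda>i. n - i" and j = "\<lambda>i. n - i"]) auto
  also have "\<dots> = (\<Sum>i\<in>{0..n}. q ^ (Suc n choose 2) * (q_stirling (1 / q) (Suc n) (Suc i) * q_fact q i))"
    using assms by (intro sum.cong HOL.refl neg_total_eq_q_stirling) auto
  finally show ?thesis by (simp add: sum_distrib_left)
qed

section \<open>Signed permutations\<close>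

text \<open>All reflections of type B in one formula: \<open>b = - a\<close> gives the sign change
  of \<open>a\<close>, any other pair the simultaneous exchange of \<open>a\<close> with
  \<open>b\<close> and of \<open>- a\<close> with \<open>- b\<close>.\<close>

definition signed_swap :: "int \<Rightarrow> int \<Rightarrow> int \<Rightarrow> int" where
  "signed_swap a b x =
     (if x = a then b else if x = b then a else if x = - a then - b else if x = - b then - a else x)"

text \<open>The value \<open>- 1\<close> makes generator 0 the sign change of 1 and the descent test
  \<open>f (i + 1) < f (simple_low i)\<close> uniform: for \<open>i = 0\<close> it says that
  \<open>f 1\<close> is negative.\<close>

definition simple_low :: "nat \<Rightarrow> int" where
  "simple_low i = (if i = 0 then - 1 else int i)"

definition simple_swap :: "nat \<Rightarrow> int \<Rightarrow> int" where
  "simple_swap i = signed_swap (simple_low i) (int i + 1)"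

definition word_perm :: "nat list \<Rightarrow> int \<Rightarrow> int" where
  "word_perm xs = foldr (\<lambda>i f. simple_swap i \<circ> f) xs id"

definition signed_range :: "nat \<Rightarrow> int set" where
  "signed_range n = {x. x \<noteq> 0 \<and> \<bar>x\<bar> \<le> int n}"

text \<open>The action is on all integers with everything beyond \<open>n\<close> fixed, so a word
  acts in the same way for every \<open>n\<close>, and letters below \<open>m\<close> fix
  \<open>m + 1\<close>.\<close>

definition signed_perms :: "nat \<Rightarrow> (int \<Rightarrow> int) set" where
  "signed_perms n = {f. inj f \<and> (\<forall>x. f (- x) = - f x) \<and> (\<forall>x. int n < \<bar>x\<bar> \<longrightarrow> f x = x)}"

definition window :: "nat \<Rightarrow> (int \<Rightarrow> int) \<Rightarrow> int list" where
  "window n f = map f [1..int n]"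

lemma signed_swap_involution: "a \<noteq> 0 \<Longrightarrow> b \<noteq> 0 \<Longrightarrow> signed_swap a b (signed_swap a b x) = x"
  by (auto simp: signed_swap_def)

lemma signed_swap_minus: "a \<noteq> 0 \<Longrightarrow> b \<noteq> 0 \<Longrightarrow> signed_swap a b (- x) = - signed_swap a b x"
  by (auto simp: signed_swap_def)

lemma inj_signed_swap: "a \<noteq> 0 \<Longrightarrow> b \<noteq> 0 \<Longrightarrow> inj (signed_swap a b)"
  by (metis injI signed_swap_involution)

lemma signed_swap_commute: "signed_swap a b = signed_swap b a"
  by (auto simp: signed_swap_def)

lemma signed_swap_uminus: "a \<noteq> 0 \<Longrightarrow> b \<noteq> 0 \<Longrightarrow> signed_swap (- a) (- b) = signed_swap a b"
  by (auto simp: signed_swap_def)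

lemma signed_swap_conj:
  assumes "inj f" "\<And>x. f (- x) = - f x"
  shows "f (signed_swap a b x) = signed_swap (f a) (f b) (f x)"
  using assms(1) unfolding signed_swap_def by (simp add: inj_eq assms(2)[symmetric])

lemma simple_low_neq [simp]: "simple_low i \<noteq> 0" "int i + 1 \<noteq> 0"
  by (auto simp: simple_low_def)

lemma simple_swap_involution [simp]: "simple_swap i (simple_swap i x) = x"
  by (simp add: simple_swap_def signed_swap_involution)

text \<open>A generator exchanges neighbours among the nonzero integers, so it reverses the order of
  a single pair and its negative. Zero is excluded because generator 0 also reverses the pair of
  \<open>- 1\<close> and 0.\<close>

lemma simple_swap_flip:
  assumes "p < q" "p \<noteq> 0" "q \<noteq> 0" "simple_swap i q < simple_swap i p"
  shows "simple_swap i = signed_swap p q"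
proof -
  have "(p = simple_low i \<and> q = int i + 1) \<or> (p = - (int i + 1) \<and> q = - simple_low i)"
    using assms unfolding simple_swap_def signed_swap_def simple_low_def
    by (auto split: if_splits)
  then show ?thesis
    unfolding simple_swap_def
    by (metis signed_swap_commute signed_swap_uminus simple_low_neq)
qed

lemma signed_perms_id [simp]: "id \<in> signed_perms n"
  by (simp add: signed_perms_def)

lemma signed_perms_comp: "f \<in> signed_perms n \<Longrightarrow> g \<in> signed_perms n \<Longrightarrow> f \<circ> g \<in> signed_perms n"
  by (auto simp: signed_perms_def inj_compose)

lemma signed_swap_in_signed_perms:
  "a \<in> signed_range n \<Longrightarrow> b \<in> signed_range n \<Longrightarrow> signed_swap a b \<in> signed_perms n"
  by (auto simp: signed_perms_def signed_range_def inj_signed_swap signed_swap_minus)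
    (auto simp: signed_swap_def)

lemma simple_in_signed_range: "i < n \<Longrightarrow> simple_low i \<in> signed_range n \<and> int i + 1 \<in> signed_range n"
  by (auto simp: signed_range_def simple_low_def)

lemma simple_swap_in_signed_perms: "i < n \<Longrightarrow> simple_swap i \<in> signed_perms n"
  by (simp add: simple_swap_def signed_swap_in_signed_perms simple_in_signed_range)

lemma word_perm_simps [simp]:
  "word_perm [] = id" "word_perm (i # xs) = simple_swap i \<circ> word_perm xs"
  by (simp_all add: word_perm_def)

lemma word_perm_append: "word_perm (xs @ ys) = word_perm xs \<circ> word_perm ys"
  by (induction xs) (auto simp: comp_assoc)

lemma word_perm_in_signed_perms: "xs \<in> lists {..<n} \<Longrightarrow> word_perm xs \<in> signed_perms n"
  by (induction xs) (auto intro: signed_perms_comp simple_swap_in_signed_perms)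

lemma signed_permsD:
  assumes "f \<in> signed_perms n"
  shows "inj f" "f (- x) = - f x" "int n < \<bar>x\<bar> \<Longrightarrow> f x = x"
  using assms by (auto simp: signed_perms_def)

lemma signed_perms_zero: "f \<in> signed_perms n \<Longrightarrow> f 0 = 0"
  using signed_permsD(2)[of f n 0] by simp

text \<open>A value beyond \<open>n\<close> is a fixed point of \<open>f\<close>, so by injectivity
  its preimage is that value itself.\<close>

lemma signed_perms_range:
  assumes "f \<in> signed_perms n" "x \<in> signed_range n"
  shows "f x \<in> signed_range n"
proof -
  have "f x \<noteq> 0"
    using assms signed_perms_zero[OF assms(1)] injD[OF signed_permsD(1)[OF assms(1)], of x 0]
    by (auto simp: signed_range_def)
  moreover have "\<bar>f x\<bar> \<le> int n"
  proof (rule ccontr)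
    assume "\<not> \<bar>f x\<bar> \<le> int n"
    then have "f (f x) = f x" using signed_permsD(3)[OF assms(1)] by simp
    then have "f x = x" using signed_permsD(1)[OF assms(1)] by (simp add: inj_eq)
    then show False using \<open>\<not> \<bar>f x\<bar> \<le> int n\<close> assms(2) by (simp add: signed_range_def)
  qed
  ultimately show ?thesis by (simp add: signed_range_def)
qed

lemma finite_signed_range: "finite (signed_range n)"
  by (rule finite_subset[of _ "{- int n..int n}"]) (auto simp: signed_range_def)

lemma signed_perms_surj:
  assumes "f \<in> signed_perms n" "y \<in> signed_range n"
  obtains x where "x \<in> signed_range n" "f x = y"
proof -
  have "f ` signed_range n = signed_range n"
    using assms(1) signed_perms_range signed_permsD(1)
    by (intro endo_inj_surj finite_signed_range) (auto intro: inj_on_subset[OF _ subset_UNIV])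
  then show ?thesis using assms(2) that by (metis imageE)
qed

lemma signed_perms_eqI:
  assumes "f \<in> signed_perms n" "g \<in> signed_perms n" "\<And>i. i \<in> {1..int n} \<Longrightarrow> f i = g i"
  shows "f = g"
proof
  fix x
  consider "int n < \<bar>x\<bar>" | "x = 0" | "x \<in> {1..int n}" | "- x \<in> {1..int n}" by force
  then show "f x = g x"
  proof cases
    case 1
    then show ?thesis using signed_permsD(3)[OF assms(1)] signed_permsD(3)[OF assms(2)] by simp
  next
    case 2
    then show ?thesis using assms(1,2) by (simp add: signed_perms_zero)
  next
    case 4
    then have "f (- x) = g (- x)" by (rule assms(3))
    then show ?thesis using signed_permsD(2) assms(1,2) by (metis minus_minus)
  qed (rule assms(3))
qed

text \<open>
  Reading the word from the right, some letter is the first to interchange the images of \<open>a\<close> and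
  \<open>b\<close>; this letter is then conjugate to \<open>signed_swap a b\<close> and can be deleted.
\<close>

lemma word_perm_exchange:
  assumes "xs \<in> lists {..<n}" "a < b" "a \<in> signed_range n" "b \<in> signed_range n"
    "word_perm xs b < word_perm xs a"
  shows "\<exists>ys\<in>lists {..<n}. length ys < length xs \<and> word_perm ys = word_perm xs \<circ> signed_swap a b"
  using assms(1,5)
proof (induction xs)
  case Nil
  then show ?case using assms(2) by simp
next
  case (Cons i xs)
  then have xs: "xs \<in> lists {..<n}" by simp
  note f = word_perm_in_signed_perms[OF xs]
  show ?case
  proof (cases "word_perm xs b < word_perm xs a")
    case True
    then obtain ys where "ys \<in> lists {..<n}" "length ys < length xs"
      "word_perm ys = word_perm xs \<circ> signed_swap a b"
      using Cons.IH by blast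
    then show ?thesis using Cons.hyps by (intro bexI[of _ "i # ys"]) (auto simp: comp_assoc)
  next
    case False
    moreover have "word_perm xs a \<noteq> word_perm xs b"
      using assms(2) signed_permsD(1)[OF f] by (simp add: inj_eq)
    moreover have "word_perm xs a \<noteq> 0" "word_perm xs b \<noteq> 0"
      using signed_perms_range[OF f] assms(3,4) by (auto simp: signed_range_def)
    ultimately have "simple_swap i = signed_swap (word_perm xs a) (word_perm xs b)"
      using Cons.prems by (intro simple_swap_flip) auto
    then have "word_perm xs (signed_swap a b x) = simple_swap i (word_perm xs x)" for x
      using signed_swap_conj[OF signed_permsD(1,2)[OF f]] by simp
    then have "word_perm (i # xs) \<circ> signed_swap a b = word_perm xs" by (simp add: fun_eq_iff)
    then show ?thesis using xs by (metis length_Cons lessI)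
  qed
qed

section \<open>The length function on windows\<close>

lemma signed_length_swap:
  "x < y \<Longrightarrow> signed_length (us @ y # x # vs) = Suc (signed_length (us @ x # y # vs))"
  by (induction us) auto

lemma set_window: "set (window n f) = f ` {1..int n}"
  by (simp add: window_def)

lemma abs_inj_on:
  assumes "f \<in> signed_perms n"
  shows "inj_on (\<lambda>x. \<bar>f x\<bar>) {1..int n}"
proof (rule inj_onI)
  fix x y assume xy: "x \<in> {1..int n}" "y \<in> {1..int n}" "\<bar>f x\<bar> = \<bar>f y\<bar>"
  then have "f x = f y \<or> f x = f (- y)" using signed_permsD(2)[OF assms] by auto
  then have "x = y \<or> x = - y" using signed_permsD(1)[OF assms] by (auto simp: inj_eq)
  then show "x = y" using xy by auto
qed

lemma abs_image:
  assumes "f \<in> signed_perms n"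
  shows "(\<lambda>x. \<bar>f x\<bar>) ` {1..int n} = {1..int n}"
proof (rule endo_inj_surj[OF _ _ abs_inj_on[OF assms]])
  show "(\<lambda>x. \<bar>f x\<bar>) ` {1..int n} \<subseteq> {1..int n}"
  proof (rule image_subsetI)
    fix x assume "x \<in> {1..int n}"
    then have "f x \<in> signed_range n"
      using signed_perms_range[OF assms, of x] by (simp add: signed_range_def)
    then show "\<bar>f x\<bar> \<in> {1..int n}" by (auto simp: signed_range_def)
  qed
qed simp

text \<open>For positive \<open>i\<close> two adjacent entries trade places and one inversion
  appears. For \<open>i = 0\<close> the positive entry \<open>f 1\<close> is negated: the new
  negative entry adds \<open>f 1\<close>, while the entries of smaller absolute value, exactly
  \<open>f 1 - 1\<close> of them since absolute values exhaust \<open>{1..n}\<close>, cease to lie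
  below the head. The net change is 1.\<close>

lemma signed_length_simple_up:
  assumes f: "f \<in> signed_perms n" and i: "i < n" "f (simple_low i) < f (int i + 1)"
  shows "signed_length (window n (f \<circ> simple_swap i)) = Suc (signed_length (window n f))"
proof (cases "i = 0")
  case False
  let ?i = "int i"
  have split: "[1..int n] = [1..?i - 1] @ ?i # (?i + 1) # [?i + 2..int n]"
    using i False upto_split3[of 1 ?i "int n"] upto_rec1[of "?i + 1" "int n"] by (simp add: add.commute)
  have "simple_swap i x = x" if "1 \<le> x" "x \<noteq> ?i" "x \<noteq> ?i + 1" for x
    using that False by (auto simp: simple_swap_def signed_swap_def simple_low_def)
  moreover have "simple_swap i ?i = ?i + 1" "simple_swap i (?i + 1) = ?i"
    using False by (auto simp: simple_swap_def signed_swap_def simple_low_def)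
  ultimately have "window n (f \<circ> simple_swap i) =
      map f [1..?i - 1] @ f (?i + 1) # f ?i # map f [?i + 2..int n]"
    unfolding window_def split using False by auto
  moreover have "window n f = map f [1..?i - 1] @ f ?i # f (?i + 1) # map f [?i + 2..int n]"
    unfolding window_def split by simp
  ultimately show ?thesis using signed_length_swap i False by (simp add: simple_low_def)
next
  case True
  let ?xs = "map f [2..int n]"
  have split: "[1..int n] = 1 # [2..int n]" using i True upto_rec1[of 1 "int n"] by simp
  have pos: "f 1 > 0" using i(2) True signed_permsD(2)[OF f, of 1] by (simp add: simple_low_def)
  have "simple_swap 0 x = x" if "2 \<le> x" for x
    using that by (auto simp: simple_swap_def signed_swap_def simple_low_def)
  moreover have "simple_swap 0 1 = - 1"
    by (auto simp: simple_swap_def signed_swap_def simple_low_def)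
  ultimately have w: "window n (f \<circ> simple_swap i) = - f 1 # ?xs" "window n f = f 1 # ?xs"
    unfolding window_def split using True signed_permsD(2)[OF f, of 1] by auto
  have dist: "distinct ?xs" using signed_permsD(1)[OF f] by (auto simp: distinct_map intro: inj_on_subset)
  have len: "length (filter P ?xs) = card {y \<in> f ` {2..int n}. P y}" for P
    using dist by (metis distinct_card distinct_filter set_filter set_map set_upto)
  have img: "abs ` (f ` {2..int n}) = {1..int n} - {f 1}"
  proof -
    have "{1..int n} = insert 1 {2..int n}" using i True by auto
    then have "insert \<bar>f 1\<bar> (abs ` (f ` {2..int n})) = {1..int n}"
      using abs_image[OF f] by (simp add: image_image)
    moreover have "\<bar>f 1\<bar> \<notin> abs ` (f ` {2..int n})"
    proof
      assume "\<bar>f 1\<bar> \<in> abs ` (f ` {2..int n})"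
      then obtain x where "x \<in> {2..int n}" "\<bar>f 1\<bar> = \<bar>f x\<bar>" by auto
      then show False using inj_onD[OF abs_inj_on[OF f], of 1 x] by auto
    qed
    ultimately have "abs ` (f ` {2..int n}) = {1..int n} - {\<bar>f 1\<bar>}" by blast
    then show ?thesis using pos by simp
  qed
  have neq: "y \<noteq> - f 1" if "y \<in> f ` {2..int n}" for y
    using that img pos by force
  let ?Y = "f ` {2..int n}"
  have "abs ` {y \<in> ?Y. \<bar>y\<bar> < f 1} = {1..<f 1}"
  proof -
    have "f 1 \<le> int n"
      using signed_perms_range[OF f, of 1] i True by (auto simp: signed_range_def)
    then have "{1..<f 1} = {z \<in> abs ` ?Y. z < f 1}" using img by auto
    then show ?thesis by auto
  qed
  moreover have "inj_on abs ?Y"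
    using inj_on_subset[OF abs_inj_on[OF f], of "{2..int n}"]
    by (auto simp: inj_on_def)
  ultimately have "card {y \<in> ?Y. \<bar>y\<bar> < f 1} = card {1..<f 1}"
    by (metis (no_types, lifting) card_image inj_on_subset mem_Collect_eq subsetI)
  then have 1: "int (card {y \<in> ?Y. \<bar>y\<bar> < f 1}) = f 1 - 1" using pos by simp
  have "{y \<in> ?Y. y < f 1} = {y \<in> ?Y. y < - f 1} \<union> {y \<in> ?Y. \<bar>y\<bar> < f 1}"
    using neq pos by force
  moreover have "card ({y \<in> ?Y. y < - f 1} \<union> {y \<in> ?Y. \<bar>y\<bar> < f 1}) =
      card {y \<in> ?Y. y < - f 1} + card {y \<in> ?Y. \<bar>y\<bar> < f 1}"
    by (intro card_Un_disjoint) auto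
  ultimately have 2: "card {y \<in> ?Y. y < f 1} = card {y \<in> ?Y. y < - f 1} + card {y \<in> ?Y. \<bar>y\<bar> < f 1}"
    by argo
  have "nat (f 1) = Suc (card {y \<in> ?Y. \<bar>y\<bar> < f 1})" using 1 by linarith
  then show ?thesis unfolding w signed_length.simps len using 2 pos by simp
qed

text \<open>The increasing case applied to \<open>f\<close> composed with the involution
  \<open>simple_swap i\<close>.\<close>

lemma signed_length_simple_down:
  assumes f: "f \<in> signed_perms n" and i: "i < n" "f (int i + 1) < f (simple_low i)"
  shows "signed_length (window n f) = Suc (signed_length (window n (f \<circ> simple_swap i)))"
proof -
  have eq: "f = (f \<circ> simple_swap i) \<circ> simple_swap i" by (simp add: fun_eq_iff)
  have "simple_swap i (simple_low i) = int i + 1" "simple_swap i (int i + 1) = simple_low i"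
    by (auto simp: simple_swap_def signed_swap_def)
  then have "(f \<circ> simple_swap i) (simple_low i) < (f \<circ> simple_swap i) (int i + 1)"
    using i by simp
  then show ?thesis
    using signed_length_simple_up[of "f \<circ> simple_swap i" n i] i f eq
    by (metis signed_perms_comp simple_swap_in_signed_perms)
qed

lemma signed_length_simple_le:
  assumes f: "f \<in> signed_perms n" and i: "i < n"
  shows "signed_length (window n (f \<circ> simple_swap i)) \<le> Suc (signed_length (window n f))"
proof -
  have "simple_low i \<noteq> int i + 1" by (simp add: simple_low_def)
  then have "f (simple_low i) \<noteq> f (int i + 1)" using signed_permsD(1)[OF f] by (simp add: inj_eq)
  then show ?thesis
    using signed_length_simple_up[OF f i] signed_length_simple_down[OF f i] by linarith
qed

lemma increasing_bounds:
  fixes f :: "int \<Rightarrow> int"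
  assumes "\<And>i. 1 \<le> i \<Longrightarrow> i < n \<Longrightarrow> f (int i) < f (int i + 1)" "1 \<le> i" "i \<le> n"
  shows "f 1 + int i - 1 \<le> f (int i)" "f (int i) \<le> f (int n) - int n + int i"
proof -
  show "f 1 + int i - 1 \<le> f (int i)" using assms(2,3)
  proof (induction i rule: dec_induct)
    case (step j)
    then show ?case using assms(1)[of j] by (simp add: add.commute)
  qed simp
  show "f (int i) \<le> f (int n) - int n + int i" using assms(3,2)
  proof (induction i rule: inc_induct)
    case (step j)
    then show ?case using assms(1)[of j] by (simp add: add.commute)
  qed simp
qed

lemma signed_length_word: "xs \<in> lists {..<n} \<Longrightarrow> signed_length (window n (word_perm xs)) \<le> length xs"
proof (induction xs rule: rev_induct)
  case Nil
  have "signed_length (map id xs) = 0" if "sorted xs" "\<forall>x\<in>set xs. x \<ge> 0" for xs :: "int list"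
    using that by (induction xs) (auto simp: filter_empty_conv)
  then show ?case by (simp add: window_def)
next
  case (snoc i xs)
  then have "signed_length (window n (word_perm xs \<circ> simple_swap i)) \<le> Suc (length xs)"
    using signed_length_simple_le[of "word_perm xs" n i] word_perm_in_signed_perms[of xs n] by force
  moreover have "word_perm (xs @ [i]) = word_perm xs \<circ> simple_swap i"
    by (simp add: word_perm_append)
  ultimately show ?case by (metis length_append_singleton)
qed

text \<open>Sorting: every descent is removed by a generator at the cost of one unit of length, and
  only the identity has no descent. With \<open>signed_length_word\<close> this identifies
  \<open>signed_length\<close> with the length of a shortest word.\<close>

lemma signed_perm_word:
  assumes "f \<in> signed_perms n"
  shows "\<exists>xs\<in>lists {..<n}. word_perm xs = f \<and> length xs = signed_length (window n f)"
  using assms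
proof (induction "signed_length (window n f)" arbitrary: f rule: less_induct)
  case less
  note f = less.prems
  show ?case
  proof (cases "\<exists>i<n. f (int i + 1) < f (simple_low i)")
    case True
    then obtain i where i: "i < n" "f (int i + 1) < f (simple_low i)" by blast
    note len = signed_length_simple_down[OF f i]
    have "f \<circ> simple_swap i \<in> signed_perms n"
      using f i(1) by (intro signed_perms_comp simple_swap_in_signed_perms)
    then obtain xs where xs: "xs \<in> lists {..<n}" "word_perm xs = f \<circ> simple_swap i"
      "length xs = signed_length (window n (f \<circ> simple_swap i))"
      using less.hyps[of "f \<circ> simple_swap i"] len by auto
    then have "word_perm (xs @ [i]) = f" by (simp add: word_perm_append fun_eq_iff)
    then show ?thesis using xs i len by (intro bexI[of _ "xs @ [i]"]) auto
  next
    case False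
    have neq: "f (simple_low i) \<noteq> f (int i + 1)" for i
      using signed_permsD(1)[OF f] by (simp add: inj_eq simple_low_def)
    have inc: "f (int i) < f (int i + 1)" if "1 \<le> i" "i < n" for i
      using False that neq[of i] by (auto simp: simple_low_def not_less dest!: spec[of _ i])
    have "f = id"
    proof (rule signed_perms_eqI[OF f signed_perms_id])
      fix x assume x: "x \<in> {1..int n}"
      then have n: "0 < n" by auto
      \<comment> \<open>Absence of a descent at 0 means \<open>f (- 1) < f 1\<close>. A strictly
        increasing integer window that starts above 0 and ends at most at \<open>n\<close> leaves no
        choice.\<close>
      then have "f 1 > 0"
        using False neq[of 0] signed_permsD(2)[OF f, of 1] by (force simp: simple_low_def)
      moreover have "f (int n) \<le> int n"
        using signed_perms_range[OF f, of "int n"] n by (auto simp: signed_range_def)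
      ultimately show "f x = id x"
        using increasing_bounds[of n f "nat x", OF inc] x by (auto simp: Suc_le_eq nat_le_iff)
    qed
    then show ?thesis using signed_length_word[of "[]" n] by (intro bexI[of _ "[]"]) auto
  qed
qed

section \<open>Dominated signed permutations and the moves between them\<close>

lemma staircase_map_upto:
  "staircase (map f [k..int n]) \<longleftrightarrow> (\<forall>i\<in>{k..int n}. i - int n - 1 \<le> f i)"
proof (induction "nat (int n + 1 - k)" arbitrary: k)
  case (Suc m)
  then have "k \<le> int n" by simp
  then have "[k..int n] = k # [k + 1..int n]" "{k..int n} = insert k {k + 1..int n}"
    by (auto simp: upto_rec1)
  then show ?case using Suc(1)[of "k + 1"] Suc(2) by auto
qed simp

definition dominated :: "nat \<Rightarrow> (int \<Rightarrow> int) \<Rightarrow> bool" where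
  "dominated n f \<longleftrightarrow> (\<forall>i\<in>{1..int n}. i - int n - 1 \<le> f i)"

lemma window_bij:
  "bij_betw (window n) {f \<in> signed_perms n. dominated n f} (signed_lists {1..int n})"
proof (rule bij_betw_imageI)
  show "inj_on (window n) {f \<in> signed_perms n. dominated n f}"
    by (rule inj_onI) (auto simp: window_def intro!: signed_perms_eqI[of _ n])
  show "window n ` {f \<in> signed_perms n. dominated n f} = signed_lists {1..int n}"
  proof (intro equalityI subsetI)
    fix ys assume "ys \<in> window n ` {f \<in> signed_perms n. dominated n f}"
    then obtain f where f: "ys = window n f" "f \<in> signed_perms n" "dominated n f" by auto
    then show "ys \<in> signed_lists {1..int n}"
      using abs_inj_on[OF f(2)] abs_image[OF f(2)] staircase_map_upto[of f 1 n]
      by (simp add: signed_lists_def window_def dominated_def distinct_map o_def image_image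
          inj_on_imageI[of abs f, unfolded o_def] inj_on_imageI2)
  next
    fix ys assume ys: "ys \<in> signed_lists {1..int n}"
    have len: "length ys = n" using length_signed_lists[OF ys] by simp
    define f where "f x = (if x \<in> {1..int n} then ys ! nat (x - 1)
      else if - x \<in> {1..int n} then - ys ! nat (- x - 1) else x)" for x
    have odd: "f (- x) = - f x" for x by (auto simp: f_def)
    have win: "window n f = ys"
      using len by (intro nth_equalityI) (auto simp: window_def f_def)
    have rng: "\<bar>f x\<bar> \<in> {1..int n}" if "x \<in> {1..int n}" for x
    proof -
      have "f x \<in> set ys" using that win set_window[of n f] by auto
      then show ?thesis using ys by (auto simp: signed_lists_def)
    qed
    have inj1: "x = y" if "x \<in> {1..int n}" "y \<in> {1..int n}" "\<bar>f x\<bar> = \<bar>f y\<bar>" for x y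
    proof -
      have "nat (x - 1) < n" "nat (y - 1) < n" using that by auto
      moreover have "map abs ys ! nat (x - 1) = map abs ys ! nat (y - 1)"
        using that calculation len by (simp add: f_def)
      ultimately have "nat (x - 1) = nat (y - 1)"
        using ys len nth_eq_iff_index_eq[of "map abs ys" "nat (x - 1)" "nat (y - 1)"]
        by (auto simp: signed_lists_def)
      then show ?thesis using that by auto
    qed
    have abs_f: "\<bar>f x\<bar> = \<bar>f \<bar>x\<bar>\<bar>" for x using odd[of x] by (auto simp: abs_if)
    have out: "f x = x" if "x \<notin> {1..int n}" "- x \<notin> {1..int n}" for x using that by (auto simp: f_def)
    have absin: "\<bar>x\<bar> \<in> {1..int n} \<longleftrightarrow> x \<in> {1..int n} \<or> - x \<in> {1..int n}" for x by auto
    \<comment> \<open>Neither the range nor its complement is left by \<open>f\<close>, so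
      injectivity can be checked separately on absolute values inside and on fixed points
      outside.\<close>
    have key: "\<bar>f x\<bar> \<in> {1..int n} \<longleftrightarrow> \<bar>x\<bar> \<in> {1..int n}" for x
      using rng[of "\<bar>x\<bar>"] abs_f[of x] out[of x] absin[of x] by metis
    have "inj f"
    proof (rule injI)
      fix x y assume eq: "f x = f y"
      have "x = y \<or> x = - y \<and> f x = - f x"
      proof (cases "\<bar>x\<bar> \<in> {1..int n}")
        case True
        then have "\<bar>x\<bar> = \<bar>y\<bar>"
          using inj1[of "\<bar>x\<bar>" "\<bar>y\<bar>"] eq abs_f[of x] abs_f[of y] key[of x] key[of y] by metis
        then show ?thesis using eq odd by (metis abs_eq_iff)
      next
        case False
        then have "f x = x" "f y = y" using eq key absin out by metis+
        then show ?thesis using eq by metis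
      qed
      moreover have "x = 0" if "f x = - f x"
        using that key[of x] out[of x] absin[of x] by (cases "\<bar>x\<bar> \<in> {1..int n}") auto
      ultimately show "x = y" by auto
    qed
    moreover have "f x = x" if "int n < \<bar>x\<bar>" for x using that by (intro out) auto
    ultimately have "f \<in> signed_perms n" using odd by (simp add: signed_perms_def)
    moreover have "dominated n f"
      using ys win staircase_map_upto[of f 1 n] by (simp add: signed_lists_def window_def dominated_def)
    ultimately show "ys \<in> window n ` {f \<in> signed_perms n. dominated n f}" using win by blast
  qed
qed

text \<open>The larger value \<open>f a\<close> moves to \<open>b\<close> and so exceeds what stood
  there; the smaller value \<open>f b\<close> moves left to \<open>a\<close>, where the bound is
  weaker. At the negative arguments oddness gives the same comparison for
  \<open>- b < - a\<close>.\<close>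

lemma dominated_down:
  assumes f: "f \<in> signed_perms n" and dom: "dominated n f"
    and ab: "a \<in> signed_range n" "b \<in> signed_range n" "a < b" "f b < f a"
  shows "dominated n (f \<circ> signed_swap a b)"
  unfolding dominated_def
proof
  fix i assume i: "i \<in> {1..int n}"
  have d: "x - int n - 1 \<le> f x" if "x \<in> signed_range n" "x > 0" for x
    using that dom by (auto simp: dominated_def signed_range_def)
  have m: "f (- x) = - f x" for x by (rule signed_permsD(2)[OF f])
  have "- a \<in> signed_range n" "- b \<in> signed_range n" using ab by (auto simp: signed_range_def)
  then show "i - int n - 1 \<le> (f \<circ> signed_swap a b) i"
    using i ab d[of a] d[of b] d[of "- a"] d[of "- b"] d[of i] m[of a] m[of b]
    by (auto simp: signed_swap_def signed_range_def)
qed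

text \<open>At the first position \<open>i\<close> that differs from the top element, the value
  there is lowered: to its negative if it is positive, and otherwise to the extreme value
  \<open>i - n - 1\<close> itself.\<close>

lemma dominated_up:
  assumes f: "f \<in> signed_perms n" and dom: "dominated n f" and ne: "\<exists>i\<in>{1..int n}. f i \<noteq> i - int n - 1"
  shows "\<exists>a\<in>signed_range n. \<exists>b\<in>signed_range n. a < b \<and> f a < f b \<and> dominated n (f \<circ> signed_swap a b)"
proof -
  have m: "f (- x) = - f x" for x by (rule signed_permsD(2)[OF f])
  have d: "x - int n - 1 \<le> f x" if "x \<in> {1..int n}" for x
    using that dom by (auto simp: dominated_def)
  have inj: "x = y" if "f x = f y" for x y
    using that signed_permsD(1)[OF f] by (simp add: inj_eq)
  define P where "P k \<longleftrightarrow> int k \<in> {1..int n} \<and> f (int k) \<noteq> int k - int n - 1" for k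
  have "\<exists>k. P k"
  proof -
    obtain i where "i \<in> {1..int n}" "f i \<noteq> i - int n - 1" using ne by blast
    then have "P (nat i)" by (simp add: P_def)
    then show ?thesis ..
  qed
  define k where "k = (LEAST k. P k)"
  have "P k" unfolding k_def using \<open>\<exists>k. P k\<close> by (rule LeastI_ex)
  define i where "i = int k"
  have i: "i \<in> {1..int n}" "f i \<noteq> i - int n - 1" using \<open>P k\<close> by (auto simp: P_def i_def)
  have less: "f x = x - int n - 1" if "x \<in> {1..<i}" for x
  proof (rule ccontr)
    assume "f x \<noteq> x - int n - 1"
    then have "P (nat x)" using that i by (auto simp: P_def)
    then have "k \<le> nat x" unfolding k_def by (rule Least_le)
    then show False using that by (auto simp: i_def)
  qed
  \<comment> \<open>\<open>- c\<close> is the extreme value at \<open>i\<close>. The positions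
    before \<open>i\<close> carry \<open>- n\<close> up to \<open>- (c + 1)\<close>, so all absolute
    values above \<open>c\<close> are used up there.\<close>
  define c where "c = int n + 1 - i"
  have c: "c > 0" "c \<le> int n" using i by (auto simp: c_def)
  have ir: "i \<in> signed_range n" "- i \<in> signed_range n" using i by (auto simp: signed_range_def)
  have lt: "- c < f i" using d[OF i(1)] i(2) by (auto simp: c_def)
  show ?thesis
  proof (cases "f i > 0")
    case True
    have le: "f i \<le> c"
    proof (rule ccontr)
      assume "\<not> f i \<le> c"
      moreover have "f i \<le> int n" using signed_perms_range[OF f ir(1)] by (auto simp: signed_range_def)
      ultimately have *: "int n + 1 - f i \<in> {1..<i}" by (auto simp: c_def)
      then have "f (- (int n + 1 - f i)) = f i" unfolding m less[OF *] by simp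
      then have "- (int n + 1 - f i) = i" by (rule inj)
      then show False using * by auto
    qed
    have "dominated n (f \<circ> signed_swap (- i) i)"
      unfolding dominated_def
    proof
      fix x assume x: "x \<in> {1..int n}"
      show "x - int n - 1 \<le> (f \<circ> signed_swap (- i) i) x"
        using x i d[OF x] le m[of i] by (auto simp: signed_swap_def c_def)
    qed
    moreover have "f (- i) < f i" "- i < i" using True m i by auto
    ultimately show ?thesis using ir by blast
  next
    case False
    obtain j where j: "j \<in> signed_range n" "f j = c"
      using signed_perms_surj[OF f, of c] c by (auto simp: signed_range_def)
    \<comment> \<open>A negative \<open>j\<close> would put \<open>- c\<close> at the positive
      position \<open>- j\<close>. Domination permits this only up to \<open>i\<close>, and there
      the values are already known to differ from \<open>- c\<close>.\<close>
    have jpos: "j > 0"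
    proof (rule ccontr)
      assume "\<not> 0 < j"
      then have j': "- j \<in> {1..int n}" using j by (auto simp: signed_range_def)
      have fj: "f (- j) = - c" using m j by simp
      then have "- j \<le> i" using d[OF j'] by (simp add: c_def)
      moreover have "- j \<noteq> i" using fj lt by auto
      ultimately have "- j \<in> {1..<i}" using j' by auto
      then show False using less[of "- j"] fj by (auto simp: c_def)
    qed
    have "i < j"
    proof (rule ccontr)
      assume "\<not> i < j"
      moreover have "j \<noteq> i" using j(2) False c by auto
      ultimately have "j \<in> {1..<i}" using jpos by auto
      then show False using less[of j] j(2) c i by auto
    qed
    \<comment> \<open>The swap puts \<open>- c\<close> at \<open>i\<close>, exactly on the bound,
      and at \<open>j\<close> the value \<open>- f i\<close>, which is not negative.\<close>
    have "dominated n (f \<circ> signed_swap (- j) i)"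
      unfolding dominated_def
    proof
      fix x assume x: "x \<in> {1..int n}"
      show "x - int n - 1 \<le> (f \<circ> signed_swap (- j) i) x"
        using x i d[OF x] m[of i] m[of j] j jpos False \<open>i < j\<close> by (auto simp: signed_swap_def c_def)
    qed
    moreover have "f (- j) < f i" "- j < i" using m j lt jpos i by auto
    moreover have "- j \<in> signed_range n" using j by (auto simp: signed_range_def)
    ultimately show ?thesis using ir by blast
  qed
qed

section \<open>The Coxeter presentation of type B\<close>

lemma simple_swap_conj: "simple_swap i (signed_swap a b x) =
  signed_swap (simple_swap i a) (simple_swap i b) (simple_swap i x)"
  by (rule signed_swap_conj) (simp_all add: simple_swap_def inj_signed_swap signed_swap_minus)

lemma simple_swap_commute:
  assumes "i \<noteq> j" "i \<noteq> Suc j" "j \<noteq> Suc i"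
  shows "simple_swap i (simple_swap j x) = simple_swap j (simple_swap i x)"
proof -
  have "simple_swap i (simple_low j) = simple_low j" "simple_swap i (int j + 1) = int j + 1"
    using assms by (auto simp: simple_swap_def signed_swap_def simple_low_def)
  then show ?thesis
    using simple_swap_conj[of i "simple_low j" "int j + 1" x] by (simp add: simple_swap_def)
qed

lemma simple_swap_braid:
  assumes "0 < i"
  shows "simple_swap i (simple_swap (Suc i) (simple_swap i x)) =
    simple_swap (Suc i) (simple_swap i (simple_swap (Suc i) x))"
proof -
  have "simple_swap i (int i + 1) = int i" "simple_swap i (int i + 2) = int i + 2"
    "simple_swap (Suc i) (int i) = int i" "simple_swap (Suc i) (int i + 1) = int i + 2"
    using assms by (auto simp: simple_swap_def signed_swap_def simple_low_def)
  moreover have "simple_swap i = signed_swap (int i) (int i + 1)"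
    "simple_swap (Suc i) = signed_swap (int i + 1) (int i + 2)"
    using assms by (auto simp: simple_swap_def simple_low_def add.commute)
  ultimately show ?thesis
    using simple_swap_conj[of i "int i + 1" "int i + 2" "simple_swap i x"]
      simple_swap_conj[of "Suc i" "int i" "int i + 1" "simple_swap (Suc i) x"]
    by (metis simple_swap_involution)
qed

lemma simple_swap_braid4:
  "simple_swap 0 (simple_swap 1 (simple_swap 0 (simple_swap 1 x))) =
    simple_swap 1 (simple_swap 0 (simple_swap 1 (simple_swap 0 x)))"
proof -
  consider "x = 1" | "x = - 1" | "x = 2" | "x = - 2" | "x \<notin> {1, - 1, 2, - 2}" by blast
  then show ?thesis
    by cases (simp_all add: simple_swap_def signed_swap_def simple_low_def)
qed

lemma word_perm_relation:
  "word_perm (concat (replicate (type_B_matrix i j) [i, j])) = id"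
proof -
  consider "i = j" | "i = 0" "j = 1" | "i = 1" "j = 0" | "0 < i" "j = Suc i" | "0 < j" "i = Suc j"
    | "i \<noteq> j" "i \<noteq> Suc j" "j \<noteq> Suc i" by force
  then show ?thesis
  proof cases
    case 1
    then show ?thesis by (simp add: type_B_matrix_def fun_eq_iff)
  next
    case 2
    then show ?thesis
      by (simp add: type_B_matrix_def fun_eq_iff numeral_eq_Suc)
        (simp add: simple_swap_braid4[simplified])
  next
    case 3
    then show ?thesis
      by (simp add: type_B_matrix_def fun_eq_iff numeral_eq_Suc insert_commute)
        (simp add: simple_swap_braid4[simplified, symmetric])
  next
    case 4
    then show ?thesis
      by (simp add: type_B_matrix_def fun_eq_iff numeral_eq_Suc doubleton_eq_iff)
        (simp add: simple_swap_braid)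
  next
    case 5
    then show ?thesis
      by (simp add: type_B_matrix_def fun_eq_iff numeral_eq_Suc doubleton_eq_iff)
        (simp add: simple_swap_braid[symmetric])
  next
    case 6
    then have "type_B_matrix i j = 2" by (auto simp: type_B_matrix_def doubleton_eq_iff)
    then show ?thesis
      using simple_swap_commute[OF 6] by (simp add: fun_eq_iff numeral_eq_Suc)
  qed
qed

lemma coxeter_eq_word_perm: "coxeter_eq I type_B_matrix xs ys \<Longrightarrow> word_perm xs = word_perm ys"
  by (induction rule: coxeter_eq.induct) (simp_all add: word_perm_append word_perm_relation)

lemma word_perm_rev: "word_perm (xs @ rev xs) = id"
proof (induction xs)
  case (Cons i xs)
  have "word_perm ((i # xs) @ rev (i # xs)) = simple_swap i \<circ> word_perm (xs @ rev xs) \<circ> simple_swap i"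
    by (simp add: word_perm_append comp_assoc)
  then show ?case using Cons.IH by (simp add: fun_eq_iff)
qed simp

text \<open>The reversed coset words act on \<open>m + 1\<close> through this ascending run;
  \<open>word_perm_rev_upt\<close> continues from \<open>- 1\<close> for the words that turn upwards
  again.\<close>

lemma word_perm_upt: "k \<le> Suc m \<Longrightarrow> word_perm [k..<Suc m] (int m + 1) = simple_low k"
proof (induction k rule: inc_induct)
  case base
  then show ?case by (simp add: simple_low_def)
next
  case (step k)
  then have "word_perm [k..<Suc m] (int m + 1) = simple_swap k (simple_low (Suc k))"
    by (subst upt_conv_Cons) (auto simp: less_Suc_eq_le)
  also have "\<dots> = simple_low k"
    by (simp add: simple_swap_def simple_low_def signed_swap_def)
  finally show ?case .
qed

lemma word_perm_rev_upt: "word_perm (rev [1..<Suc k]) (- 1) = - (int k + 1)"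
  by (induction k) (auto simp: simple_swap_def simple_low_def signed_swap_def)

text \<open>Words run over indices rather than group elements, so \<open>word_perm\<close> can be
  applied before \<open>s\<close> is known to be injective.\<close>

locale type_B = group G for G (structure) +
  fixes s :: "nat \<Rightarrow> 'a" and n :: nat
  assumes gen_closed [simp, intro]: "i < n \<Longrightarrow> s i \<in> carrier G"
    and gen_generate: "generate G (s ` {..<n}) = carrier G"
    and word_eq_iff: "\<lbrakk>xs \<in> lists {..<n}; ys \<in> lists {..<n}\<rbrakk> \<Longrightarrow>
      list_mult G (map s xs) = list_mult G (map s ys) \<longleftrightarrow> coxeter_eq {..<n} type_B_matrix xs ys"
begin

definition word_val :: "nat list \<Rightarrow> 'a" where
  "word_val xs = list_mult G (map s xs)"

lemma word_val_simps [simp]: "word_val [] = \<one>" "word_val (i # xs) = s i \<otimes> word_val xs"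
  by (simp_all add: word_val_def list_mult_def)

lemma word_val_closed [simp, intro]: "xs \<in> lists {..<n} \<Longrightarrow> word_val xs \<in> carrier G"
  by (induction xs) auto

lemma word_val_append:
  "xs \<in> lists {..<n} \<Longrightarrow> ys \<in> lists {..<n} \<Longrightarrow> word_val (xs @ ys) = word_val xs \<otimes> word_val ys"
  by (induction xs) (auto simp: m_assoc intro!: m_assoc[symmetric])

lemma word_val_eq_imp_word_perm_eq:
  "\<lbrakk>xs \<in> lists {..<n}; ys \<in> lists {..<n}; word_val xs = word_val ys\<rbrakk> \<Longrightarrow> word_perm xs = word_perm ys"
  using word_eq_iff coxeter_eq_word_perm unfolding word_val_def by blast

lemma word_val_relation:
  assumes "i < n" "j < n"
  shows "word_val (concat (replicate (type_B_matrix i j) [i, j])) = \<one>"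
proof -
  have "coxeter_eq {..<n} type_B_matrix ([] @ concat (replicate (type_B_matrix i j) [i, j]) @ []) ([] @ [])"
    using assms by (intro coxeter_eq.rel) (auto simp: type_B_matrix_def)
  moreover have "concat (replicate k [i, j]) \<in> lists {..<n}" for k
    using assms by (induction k) auto
  ultimately have "word_val (concat (replicate (type_B_matrix i j) [i, j])) = word_val []"
    unfolding word_val_def by (subst word_eq_iff) auto
  then show ?thesis by simp
qed

section \<open>Rewriting with the defining relations in the abstract group\<close>

lemma gen_square [simp]: "i < n \<Longrightarrow> s i \<otimes> s i = \<one>"
  using word_val_relation[of i i] by (simp add: type_B_matrix_def)

lemma gen_square_assoc [simp]: "i < n \<Longrightarrow> x \<in> carrier G \<Longrightarrow> s i \<otimes> (s i \<otimes> x) = x"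
  by (simp add: m_assoc[symmetric])

lemma gen_inv [simp]: "i < n \<Longrightarrow> inv (s i) = s i"
  by (rule inv_equality) auto

lemma gen_commute:
  assumes "i < n" "Suc j < i"
  shows "s i \<otimes> s j = s j \<otimes> s i"
proof -
  have "s i \<otimes> (s j \<otimes> (s i \<otimes> s j)) = \<one>"
    using word_val_relation[of i j] assms
    by (auto simp: type_B_matrix_def numeral_eq_Suc doubleton_eq_iff)
  then have "s j \<otimes> (s i \<otimes> (s i \<otimes> (s j \<otimes> (s i \<otimes> s j)))) = s j \<otimes> (s i \<otimes> \<one>)" by simp
  then show ?thesis using assms by simp
qed

lemma gen_braid:
  assumes "Suc i < n" "0 < i"
  shows "s i \<otimes> (s (Suc i) \<otimes> s i) = s (Suc i) \<otimes> (s i \<otimes> s (Suc i))"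
proof -
  have "s i \<otimes> (s (Suc i) \<otimes> (s i \<otimes> (s (Suc i) \<otimes> (s i \<otimes> s (Suc i))))) = \<one>"
    using word_val_relation[of i "Suc i"] assms
    by (auto simp: type_B_matrix_def numeral_eq_Suc doubleton_eq_iff)
  then have "(s i \<otimes> (s (Suc i) \<otimes> s i)) \<otimes> (s (Suc i) \<otimes> (s i \<otimes> s (Suc i))) =
      (s (Suc i) \<otimes> (s i \<otimes> s (Suc i))) \<otimes> (s (Suc i) \<otimes> (s i \<otimes> s (Suc i)))"
    using assms by (simp add: m_assoc)
  then show ?thesis using assms by (subst (asm) right_cancel) auto
qed

lemma gen_braid4:
  assumes "1 < n"
  shows "s 1 \<otimes> (s 0 \<otimes> (s 1 \<otimes> s 0)) = s 0 \<otimes> (s 1 \<otimes> (s 0 \<otimes> s 1))"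
proof -
  have n: "0 < n" "Suc 0 < n" using assms by auto
  have "s 1 \<otimes> (s 0 \<otimes> (s 1 \<otimes> (s 0 \<otimes> (s 1 \<otimes> (s 0 \<otimes> (s 1 \<otimes> s 0)))))) = \<one>"
    using word_val_relation[of 1 0] n
    by (simp add: type_B_matrix_def numeral_eq_Suc insert_commute)
  then have "(s 1 \<otimes> (s 0 \<otimes> (s 1 \<otimes> s 0))) \<otimes> (s 1 \<otimes> (s 0 \<otimes> (s 1 \<otimes> s 0))) =
      (s 0 \<otimes> (s 1 \<otimes> (s 0 \<otimes> s 1))) \<otimes> (s 1 \<otimes> (s 0 \<otimes> (s 1 \<otimes> s 0)))"
    using n by (simp add: m_assoc)
  then show ?thesis using n by (subst (asm) right_cancel) auto
qed

lemma gen_commute_assoc: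
  assumes "i < n" "Suc j < i" "x \<in> carrier G"
  shows "x \<otimes> s i \<otimes> s j = x \<otimes> s j \<otimes> s i" "x \<otimes> s j \<otimes> s i = x \<otimes> s i \<otimes> s j"
  using assms gen_commute[OF assms(1,2)] by (simp_all add: m_assoc)

text \<open>
  The words \<open>m, \<dots>, k\<close> and \<open>m, \<dots>, 0, 1, \<dots>, k\<close> represent the right cosets of the subgroup
  generated by the letters below \<open>m\<close> in the one generated by the letters up to \<open>m\<close>; they are told
  apart by the preimage of \<open>m + 1\<close> under the associated signed permutation.
\<close>

definition down_word :: "nat \<Rightarrow> nat \<Rightarrow> nat list" where
  "down_word m k = rev [k..<Suc m]"

definition up_word :: "nat \<Rightarrow> nat \<Rightarrow> nat list" where
  "up_word m k = down_word m 0 @ [1..<Suc k]"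

lemma down_word_lists: "m < n \<Longrightarrow> down_word m k \<in> lists {..<n}"
  by (auto simp: down_word_def)

lemma up_word_lists: "m < n \<Longrightarrow> k \<le> m \<Longrightarrow> up_word m k \<in> lists {..<n}"
  by (auto simp: up_word_def down_word_def)

lemma down_word_top [simp]: "down_word m (Suc m) = []"
  by (simp add: down_word_def)

lemma up_word_0 [simp]: "up_word m 0 = down_word m 0"
  by (simp add: up_word_def)

lemma word_val_down_word_step:
  assumes "m < n" "k \<le> m"
  shows "word_val (down_word m k) = word_val (down_word m (Suc k)) \<otimes> s k"
proof -
  have "down_word m k = down_word m (Suc k) @ [k]"
    unfolding down_word_def using assms by (subst upt_conv_Cons) auto
  then show ?thesis
    using word_val_append[OF down_word_lists[OF assms(1)], of "[k]" "Suc k"] assms by simp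
qed

lemma word_val_up_word_step:
  assumes "m < n" "Suc k \<le> m"
  shows "word_val (up_word m (Suc k)) = word_val (up_word m k) \<otimes> s (Suc k)"
proof -
  have "up_word m (Suc k) = up_word m k @ [Suc k]" by (simp add: up_word_def)
  then show ?thesis
    using word_val_append[OF up_word_lists[OF assms(1)], of k "[Suc k]"] assms
    by simp
qed

lemma down_word_commute_low:
  assumes "m < n" "Suc i < k" "k \<le> Suc m"
  shows "word_val (down_word m k) \<otimes> s i = s i \<otimes> word_val (down_word m k)"
  using assms(3,2)
proof (induction k rule: inc_induct)
  case base
  then show ?case using assms by simp
next
  case (step k)
  have d: "word_val (down_word m (Suc k)) \<in> carrier G" using assms(1) by (intro word_val_closed down_word_lists)
  have "word_val (down_word m k) \<otimes> s i = word_val (down_word m (Suc k)) \<otimes> s i \<otimes> s k"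
    using step assms d gen_commute_assoc(1)[of k i] by (simp add: word_val_down_word_step)
  also have "\<dots> = s i \<otimes> word_val (down_word m (Suc k)) \<otimes> s k" using step by simp
  finally show ?case using step assms d by (simp add: word_val_down_word_step m_assoc)
qed

text \<open>The letter \<open>i + 1\<close> passes the letters below \<open>i\<close>, the braid
  relation turns it into \<open>i\<close>, and this passes the letters above \<open>i + 1\<close>:
  the index drops by one.\<close>

lemma down_word_commute_high:
  assumes "m < n" "0 < i" "Suc i \<le> m" "k \<le> i"
  shows "word_val (down_word m k) \<otimes> s (Suc i) = s i \<otimes> word_val (down_word m k)"
  using assms(4)
proof (induction k rule: inc_induct)
  case base
  let ?d = "word_val (down_word m (Suc (Suc i)))"
  have d: "?d \<in> carrier G" using assms(1) by (intro word_val_closed down_word_lists)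
  have eq: "word_val (down_word m i) = ?d \<otimes> s (Suc i) \<otimes> s i"
    using assms by (simp only: word_val_down_word_step)
  have "word_val (down_word m i) \<otimes> s (Suc i) = ?d \<otimes> (s (Suc i) \<otimes> (s i \<otimes> s (Suc i)))"
    unfolding eq using assms d by (simp add: m_assoc)
  also have "\<dots> = (?d \<otimes> s i) \<otimes> (s (Suc i) \<otimes> s i)"
    using assms d gen_braid[of i] by (simp add: m_assoc)
  also have "?d \<otimes> s i = s i \<otimes> ?d" using assms by (intro down_word_commute_low) auto
  finally show ?case unfolding eq using assms d by (simp add: m_assoc)
next
  case (step k)
  have d: "word_val (down_word m (Suc k)) \<in> carrier G" using assms(1) by (intro word_val_closed down_word_lists)
  have "word_val (down_word m k) \<otimes> s (Suc i) = word_val (down_word m (Suc k)) \<otimes> s (Suc i) \<otimes> s k"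
    using step assms d gen_commute_assoc(2)[of "Suc i" k] by (simp add: word_val_down_word_step)
  also have "\<dots> = s i \<otimes> word_val (down_word m (Suc k)) \<otimes> s k" using step by simp
  finally show ?case using step assms d by (simp add: word_val_down_word_step m_assoc)
qed

lemma up_word_commute_high:
  assumes "m < n" "Suc i \<le> m" "k < i"
  shows "word_val (up_word m k) \<otimes> s (Suc i) = s i \<otimes> word_val (up_word m k)"
  using assms(3)
proof (induction k)
  case 0
  then show ?case using down_word_commute_high[of m i 0] assms by simp
next
  case (Suc k)
  have u: "word_val (up_word m k) \<in> carrier G" using Suc assms by (intro word_val_closed up_word_lists) auto
  have eq: "word_val (up_word m (Suc k)) = word_val (up_word m k) \<otimes> s (Suc k)"
    using Suc assms by (intro word_val_up_word_step) auto
  have "word_val (up_word m (Suc k)) \<otimes> s (Suc i) = word_val (up_word m k) \<otimes> s (Suc i) \<otimes> s (Suc k)"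
    unfolding eq using Suc assms u by (intro gen_commute_assoc(2)) auto
  also have "word_val (up_word m k) \<otimes> s (Suc i) = s i \<otimes> word_val (up_word m k)" using Suc by simp
  finally show ?case unfolding eq using Suc assms u by (simp add: m_assoc)
qed

text \<open>Moving left, a positive letter is raised by one in the ascending part and lowered again
  in the descending part. For \<open>i = 0\<close> the same effect comes from the relation of order
  4 between letters 0 and 1.\<close>

lemma up_word_commute_low:
  assumes "m < n" "k \<le> m" "i < k"
  shows "word_val (up_word m k) \<otimes> s i = s i \<otimes> word_val (up_word m k)"
proof -
  have "Suc i \<le> k" using assms by simp
  then show ?thesis using assms(2)
  proof (induction k rule: dec_induct)
    case base
    show ?case
    proof (cases i)
      case 0
      let ?d = "word_val (down_word m 2)"
      have d: "?d \<in> carrier G" using assms(1) by (intro word_val_closed down_word_lists)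
      have "word_val (down_word m 0) = ?d \<otimes> s 1 \<otimes> s 0"
        using assms base by (simp only: word_val_down_word_step numeral_2_eq_2 One_nat_def)
      then have eq: "word_val (up_word m 1) = ?d \<otimes> s 1 \<otimes> s 0 \<otimes> s 1"
        using word_val_up_word_step[of m 0] assms base by simp
      have "word_val (up_word m 1) \<otimes> s 0 = ?d \<otimes> (s 1 \<otimes> (s 0 \<otimes> (s 1 \<otimes> s 0)))"
        unfolding eq using assms d by (simp add: m_assoc)
      also have "\<dots> = (?d \<otimes> s 0) \<otimes> (s 1 \<otimes> (s 0 \<otimes> s 1))"
        using assms d base by (subst gen_braid4) (auto simp: m_assoc)
      also have "?d \<otimes> s 0 = s 0 \<otimes> ?d" using assms base by (intro down_word_commute_low) auto
      finally show ?thesis using eq assms d 0 by (simp add: m_assoc)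
    next
      case (Suc j)
      let ?u = "word_val (up_word m j)"
      have u: "?u \<in> carrier G" using assms Suc base by (intro word_val_closed up_word_lists) auto
      have eq: "word_val (up_word m (Suc i)) = ?u \<otimes> s i \<otimes> s (Suc i)"
        using assms base Suc by (simp only: word_val_up_word_step)
      have "word_val (up_word m (Suc i)) \<otimes> s i = ?u \<otimes> (s i \<otimes> (s (Suc i) \<otimes> s i))"
        unfolding eq using assms base u by (simp add: m_assoc)
      also have "\<dots> = (?u \<otimes> s (Suc i)) \<otimes> (s i \<otimes> s (Suc i))"
        using assms base u Suc by (subst gen_braid) (auto simp: m_assoc)
      also have "?u \<otimes> s (Suc i) = s i \<otimes> ?u"
        using assms base Suc by (intro up_word_commute_high) auto
      finally show ?thesis unfolding eq using assms base u by (simp add: m_assoc)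
    qed
  next
    case (step k)
    have u: "word_val (up_word m k) \<in> carrier G" using step assms by (intro word_val_closed up_word_lists) auto
    have eq: "word_val (up_word m (Suc k)) = word_val (up_word m k) \<otimes> s (Suc k)"
      using step assms by (intro word_val_up_word_step) auto
    have "word_val (up_word m (Suc k)) \<otimes> s i = word_val (up_word m k) \<otimes> s i \<otimes> s (Suc k)"
      unfolding eq using step assms u by (intro gen_commute_assoc(1)) auto
    also have "word_val (up_word m k) \<otimes> s i = s i \<otimes> word_val (up_word m k)" using step by simp
    finally show ?case unfolding eq using step assms u by (simp add: m_assoc)
  qed
qed

definition coset_words :: "nat \<Rightarrow> nat list set" where
  "coset_words m = {down_word m k | k. k \<le> Suc m} \<union> {up_word m k | k. 0 < k \<and> k \<le> m}"

lemma coset_words_lists: "m < n \<Longrightarrow> u \<in> coset_words m \<Longrightarrow> u \<in> lists {..<n}"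
  unfolding coset_words_def using down_word_lists up_word_lists by blast

text \<open>A finite check that the cosets listed by \<open>coset_words\<close> are closed under
  right multiplication by the letters up to \<open>m\<close>; letters that do not change the coset
  come out on the left with index below \<open>m\<close>.\<close>

lemma coset_words_mult:
  assumes "m < n" "u \<in> coset_words m" "i \<le> m"
  shows "(\<exists>v\<in>coset_words m. word_val u \<otimes> s i = word_val v) \<or> (\<exists>j<m. word_val u \<otimes> s i = s j \<otimes> word_val u)"
proof -
  have dw: "down_word m k \<in> coset_words m" if "k \<le> Suc m" for k
    using that by (auto simp: coset_words_def)
  have uw: "up_word m k \<in> coset_words m" if "k \<le> m" for k
    using that dw[of 0] by (cases "k = 0") (simp, auto simp: coset_words_def)
  have closed: "word_val v \<in> carrier G" if "v \<in> coset_words m" for v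
    using coset_words_lists[OF assms(1) that] by blast
  have in_n: "i < n" using assms by simp
  consider (down) k where "u = down_word m k" "k \<le> Suc m"
    | (up) k where "u = up_word m k" "0 < k" "k \<le> m"
    using assms(2) by (auto simp: coset_words_def)
  then show ?thesis
  proof cases
    case (down k)
    \<comment> \<open>The word ending in 1, 0 is special: letter 1 cannot be lowered through it and
      instead starts the ascending part.\<close>
    consider "k = Suc i" | "k = i" | "Suc i < k" | "k = 0" "i = 1" | "k < i" "1 < i"
      by linarith
    then show ?thesis
    proof cases
      case 1
      then have "word_val u \<otimes> s i = word_val (down_word m i)"
        using word_val_down_word_step[OF assms(1,3)] down by simp
      then show ?thesis using dw[of i] assms(3) by (metis le_SucI)
    next
      case 2
      then have "word_val u = word_val (down_word m (Suc i)) \<otimes> s i"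
        using word_val_down_word_step[OF assms(1,3)] down by simp
      then have "word_val u \<otimes> s i = word_val (down_word m (Suc i))"
        using closed[OF dw[of "Suc i"]] assms(3) in_n by (simp add: m_assoc)
      then show ?thesis using dw[of "Suc i"] assms(3) by (metis Suc_le_mono)
    next
      case 3
      then show ?thesis
        using down_word_commute_low[OF assms(1) 3] down by (intro disjI2 exI[of _ i]) simp
    next
      case 4
      then have "word_val u \<otimes> s i = word_val (up_word m 1)"
        using word_val_up_word_step[of m 0] assms down by simp
      then show ?thesis using uw[of 1] assms(3) 4 by metis
    next
      case 5
      then show ?thesis
        using down_word_commute_high[of m "i - 1" k] down assms
        by (intro disjI2 exI[of _ "i - 1"]) simp
    qed
  next
    case (up k)
    consider "i = Suc k" | "i = k" | "i < k" | "Suc k < i"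
      by linarith
    then show ?thesis
    proof cases
      case 1
      then have "word_val u \<otimes> s i = word_val (up_word m i)"
        using word_val_up_word_step[of m k] assms up by simp
      then show ?thesis using uw[of i] assms(3) by metis
    next
      case 2
      then obtain j where j: "k = Suc j" using up by (cases k) auto
      then have "word_val u = word_val (up_word m j) \<otimes> s i"
        using word_val_up_word_step[of m j] assms up 2 by simp
      moreover have "word_val (up_word m j) \<in> carrier G" using closed[OF uw[of j]] j up by simp
      ultimately have "word_val u \<otimes> s i = word_val (up_word m j)"
        using in_n by (simp add: m_assoc)
      then show ?thesis using uw[of j] j up by (metis Suc_leD)
    next
      case 3
      then show ?thesis
        using up_word_commute_low[of m k i] up assms by (intro disjI2 exI[of _ i]) simp
    next
      case 4
      then show ?thesis
        using up_word_commute_high[of m "i - 1" k] up assms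
        by (intro disjI2 exI[of _ "i - 1"]) simp
    qed
  qed
qed

section \<open>Normal form and faithfulness of the signed permutation action\<close>

lemma coset_normal_form:
  assumes "m < n" "xs \<in> lists {..<Suc m}"
  shows "\<exists>ys\<in>lists {..<m}. \<exists>u\<in>coset_words m. word_val xs = word_val (ys @ u)"
  using assms(2)
proof (induction xs rule: rev_induct)
  case Nil
  have "[] \<in> coset_words m" unfolding coset_words_def by (auto intro!: exI[of _ "Suc m"] simp: down_word_def)
  then show ?case by (intro bexI[of _ "[]"]) auto
next
  case (snoc i xs)
  then obtain ys u where ys: "ys \<in> lists {..<m}" "u \<in> coset_words m" "word_val xs = word_val (ys @ u)"
    by auto
  have i: "i \<le> m" "i < n" "xs \<in> lists {..<n}" using snoc.prems assms(1) by auto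
  have l: "ys \<in> lists {..<n}" "u \<in> lists {..<n}"
    using ys assms(1) coset_words_lists by auto
  have eq: "word_val (xs @ [i]) = word_val ys \<otimes> (word_val u \<otimes> s i)"
    using i l ys(3) by (simp add: word_val_append m_assoc)
  from coset_words_mult[OF assms(1) ys(2) i(1)] show ?case
  proof
    assume "\<exists>v\<in>coset_words m. word_val u \<otimes> s i = word_val v"
    then obtain v where v: "v \<in> coset_words m" "word_val u \<otimes> s i = word_val v" by blast
    then have "word_val (xs @ [i]) = word_val (ys @ v)"
      using eq l coset_words_lists[OF assms(1) v(1)] by (simp add: word_val_append)
    then show ?thesis using ys v by blast
  next
    assume "\<exists>j<m. word_val u \<otimes> s i = s j \<otimes> word_val u"
    then obtain j where j: "j < m" "word_val u \<otimes> s i = s j \<otimes> word_val u" by blast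
    then have "word_val (xs @ [i]) = word_val ((ys @ [j]) @ u)"
      using eq l assms(1) by (simp add: word_val_append)
    moreover have "ys @ [j] \<in> lists {..<m}" using ys j by simp
    ultimately show ?thesis using ys(2) by blast
  qed
qed

text \<open>In the normal form \<open>ys @ u\<close> the factor \<open>ys\<close> fixes
  \<open>m + 1\<close>, hence so does the inverse of \<open>u\<close>. The inverse of a nonempty
  coset word moves \<open>m + 1\<close>, so \<open>u\<close> is empty and the induction continues
  with fewer letters.\<close>

lemma word_val_one:
  assumes "m \<le> n" "xs \<in> lists {..<m}" "word_perm xs = id"
  shows "word_val xs = \<one>"
  using assms
proof (induction m arbitrary: xs)
  case 0
  then show ?case by simp
next
  case (Suc m)
  then have m: "m < n" by simp
  obtain ys u where ys: "ys \<in> lists {..<m}" "u \<in> coset_words m" "word_val xs = word_val (ys @ u)"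
    using coset_normal_form[OF m Suc.prems(2)] by blast
  have l: "xs \<in> lists {..<n}" "ys \<in> lists {..<n}" "u \<in> lists {..<n}"
    using Suc.prems ys coset_words_lists[OF m] m by (auto simp: less_Suc_eq_le)
  have wp: "word_perm ys \<circ> word_perm u = id"
    using word_val_eq_imp_word_perm_eq[OF l(1) _ ys(3)] l Suc.prems(3) by (metis append_in_lists_conv word_perm_append)
  have "word_perm u (word_perm (rev u) (int m + 1)) = int m + 1"
    using fun_cong[OF word_perm_rev[of u], of "int m + 1"] by (simp add: word_perm_append)
  moreover have "word_perm ys (int m + 1) = int m + 1"
    using signed_permsD(3)[OF word_perm_in_signed_perms[OF ys(1)]] by simp
  ultimately have fix_top: "word_perm (rev u) (int m + 1) = int m + 1"
    using fun_cong[OF wp, of "word_perm (rev u) (int m + 1)"] by simp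
  have "u = []"
  proof -
    consider (down) k where "u = down_word m k" "k \<le> Suc m"
      | (up) k where "u = up_word m k" "0 < k" "k \<le> m"
      using ys(2) by (auto simp: coset_words_def)
    then show ?thesis
    proof cases
      case (down k)
      then have "simple_low k = int m + 1" using fix_top word_perm_upt[of k m] by (simp add: down_word_def)
      then have "k = Suc m" by (simp add: simple_low_def split: if_splits)
      then show ?thesis using down by simp
    next
      case (up k)
      have "rev u = rev [1..<Suc k] @ [0..<Suc m]" using up by (simp add: up_word_def down_word_def)
      then have "word_perm (rev u) (int m + 1) = word_perm (rev [1..<Suc k]) (- 1)"
        using word_perm_upt[of 0 m] by (simp add: word_perm_append simple_low_def del: upt_Suc)
      then have False using fix_top word_perm_rev_upt[of k] by simp
      then show ?thesis ..
    qed
  qed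
  then have "word_perm ys = id" "word_val xs = word_val ys" using wp ys by auto
  then show ?case using Suc.IH[OF _ ys(1)] m by simp
qed

lemma word_val_rev: "xs \<in> lists {..<n} \<Longrightarrow> word_val (rev xs) \<otimes> word_val xs = \<one>"
proof (induction xs)
  case (Cons i xs)
  then have l: "i < n" "xs \<in> lists {..<n}" "rev xs \<in> lists {..<n}" by auto
  then have "word_val (rev (i # xs)) \<otimes> word_val (i # xs) = word_val (rev xs) \<otimes> word_val xs"
    by (simp add: word_val_append m_assoc)
  then show ?case using Cons by simp
qed simp

lemma word_val_eq_iff:
  assumes "xs \<in> lists {..<n}" "ys \<in> lists {..<n}"
  shows "word_val xs = word_val ys \<longleftrightarrow> word_perm xs = word_perm ys"
proof
  assume eq: "word_perm xs = word_perm ys"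
  have l: "rev xs \<in> lists {..<n}" using assms by auto
  have "word_perm (rev xs) \<circ> word_perm ys = id"
    using word_perm_rev[of "rev xs"] eq by (simp add: word_perm_append)
  then have "word_val (rev xs @ ys) = \<one>"
    using assms l by (intro word_val_one[of n]) (auto simp: word_perm_append)
  then have "word_val (rev xs) \<otimes> word_val ys = word_val (rev xs) \<otimes> word_val xs"
    using assms l word_val_rev by (simp add: word_val_append)
  then show "word_val xs = word_val ys" using assms l by (subst (asm) Units_l_cancel) auto
qed (rule word_val_eq_imp_word_perm_eq[OF assms])

end

section \<open>The Bruhat interval below the maximal coset representative\<close>

context type_B
begin

abbreviation gens :: "'a set" where
  "gens \<equiv> s ` {..<n}"

lemma carrier_word:
  assumes "g \<in> carrier G"
  obtains xs where "xs \<in> lists {..<n}" "word_val xs = g"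
proof -
  have "g \<in> generate G gens" using assms gen_generate by simp
  then have "\<exists>xs\<in>lists {..<n}. word_val xs = g"
  proof (induction rule: generate.induct)
    case one
    then show ?case by (intro bexI[of _ "[]"]) auto
  next
    case (incl h)
    then obtain i where "i < n" "h = s i" by auto
    then show ?case by (intro bexI[of _ "[i]"]) auto
  next
    case (inv h)
    then obtain i where "i < n" "h = s i" by auto
    then show ?case by (intro bexI[of _ "[i]"]) auto
  next
    case (eng g h)
    then obtain xs ys where "xs \<in> lists {..<n}" "word_val xs = g" "ys \<in> lists {..<n}" "word_val ys = h"
      by auto
    then show ?case by (intro bexI[of _ "xs @ ys"]) (auto simp: word_val_append)
  qed
  then show ?thesis using that by blast
qed

text \<open>The choice of the word is immaterial by \<open>word_val_eq_iff\<close>, so on the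
  carrier this is the isomorphism onto \<open>signed_perms n\<close>.\<close>

definition perm :: "'a \<Rightarrow> int \<Rightarrow> int" where
  "perm g = word_perm (SOME xs. xs \<in> lists {..<n} \<and> word_val xs = g)"

lemma perm_word_val: "xs \<in> lists {..<n} \<Longrightarrow> perm (word_val xs) = word_perm xs"
  unfolding perm_def
  by (rule someI2[of _ xs]) (use word_val_eq_iff in auto)

lemma perm_mult:
  assumes "g \<in> carrier G" "h \<in> carrier G"
  shows "perm (g \<otimes> h) = perm g \<circ> perm h"
proof -
  obtain xs where xs: "xs \<in> lists {..<n}" "word_val xs = g" using carrier_word assms(1) by blast
  obtain ys where ys: "ys \<in> lists {..<n}" "word_val ys = h" using carrier_word assms(2) by blast
  have "perm (word_val (xs @ ys)) = word_perm xs \<circ> word_perm ys"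
    using xs ys by (subst perm_word_val) (auto simp: word_perm_append)
  then show ?thesis using xs ys perm_word_val word_val_append by metis
qed

lemma perm_one: "perm \<one> = id"
  using perm_word_val[of "[]"] by simp

lemma perm_gen: "i < n \<Longrightarrow> perm (s i) = simple_swap i"
  using perm_word_val[of "[i]"] by simp

lemma perm_in_signed_perms: "g \<in> carrier G \<Longrightarrow> perm g \<in> signed_perms n"
  by (metis carrier_word perm_word_val word_perm_in_signed_perms)

lemma perm_eqD: "g \<in> carrier G \<Longrightarrow> h \<in> carrier G \<Longrightarrow> perm g = perm h \<Longrightarrow> g = h"
  by (metis carrier_word perm_word_val word_val_eq_iff)

lemma perm_surj:
  assumes "f \<in> signed_perms n"
  obtains g where "g \<in> carrier G" "perm g = f"
  by (metis assms perm_word_val signed_perm_word that word_val_closed)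

lemma coxeter_length_perm:
  assumes "g \<in> carrier G"
  shows "coxeter_length G gens g = signed_length (window n (perm g))"
  unfolding coxeter_length_def
proof (rule Least_equality)
  obtain xs where "xs \<in> lists {..<n}" "word_perm xs = perm g" "length xs = signed_length (window n (perm g))"
    using signed_perm_word[OF perm_in_signed_perms[OF assms]] by blast
  moreover from this have "word_val xs = g" using assms by (intro perm_eqD) (auto simp: perm_word_val)
  ultimately show "\<exists>xs\<in>lists gens. length xs = signed_length (window n (perm g)) \<and> list_mult G xs = g"
    by (intro bexI[of _ "map s xs"]) (auto simp: word_val_def)
next
  fix k assume "\<exists>xs\<in>lists gens. length xs = k \<and> list_mult G xs = g"
  then obtain ys where ys: "ys \<in> lists gens" "length ys = k" "list_mult G ys = g" by blast
  then obtain xs where "xs \<in> lists {..<n}" "ys = map s xs" by (auto simp: lists_image)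
  then show "signed_length (window n (perm g)) \<le> k"
    using signed_length_word[of xs n] perm_word_val[of xs] ys by (simp add: word_val_def)
qed

text \<open>The exchange property shortens a reduced word of \<open>g\<close>, which gives the
  strict decrease without evaluating the length formula at an arbitrary reflection.\<close>

lemma coxeter_length_swap:
  assumes "g \<in> carrier G" "h \<in> carrier G" "a \<in> signed_range n" "b \<in> signed_range n" "a < b"
    "perm h = perm g \<circ> signed_swap a b" "perm g b < perm g a"
  shows "coxeter_length G gens h < coxeter_length G gens g"
proof -
  obtain xs where xs: "xs \<in> lists {..<n}" "word_perm xs = perm g"
    "length xs = signed_length (window n (perm g))"
    using signed_perm_word[OF perm_in_signed_perms[OF assms(1)]] by blast
  obtain ys where "ys \<in> lists {..<n}" "length ys < length xs" "word_perm ys = perm h"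
    using word_perm_exchange[OF xs(1) assms(5,3,4)] xs(2) assms(6,7) by auto
  then show ?thesis using signed_length_word[of ys n] xs(3) assms by (simp add: coxeter_length_perm)
qed

lemma perm_conj:
  assumes "x \<in> carrier G" "i < n"
  shows "perm (x \<otimes> s i \<otimes> inv x) = signed_swap (perm x (simple_low i)) (perm x (int i + 1))"
proof
  fix z
  note f = perm_in_signed_perms[OF assms(1)]
  have "perm x \<circ> perm (inv x) = id" using assms perm_mult[of x "inv x"] by (simp add: perm_one)
  then have "perm x (perm (inv x) z) = z" by (metis comp_apply id_apply)
  moreover have "perm (x \<otimes> s i \<otimes> inv x) z = perm x (simple_swap i (perm (inv x) z))"
    using assms by (simp add: perm_mult perm_gen)
  ultimately show "perm (x \<otimes> s i \<otimes> inv x) z = signed_swap (perm x (simple_low i)) (perm x (int i + 1)) z"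
    using signed_swap_conj[OF signed_permsD(1,2)[OF f], of "simple_low i" "int i + 1" "perm (inv x) z"]
    by (simp add: simple_swap_def)
qed

lemma reflections_carrier: "t \<in> reflections G gens \<Longrightarrow> t \<in> carrier G"
  by (auto simp: reflections_def)

lemma perm_reflection:
  assumes "t \<in> reflections G gens"
  obtains a b where "a \<in> signed_range n" "b \<in> signed_range n" "a < b" "perm t = signed_swap a b"
proof -
  obtain x i where x: "x \<in> carrier G" "i < n" "t = x \<otimes> s i \<otimes> inv x"
    using assms by (auto simp: reflections_def)
  let ?a = "perm x (simple_low i)" and ?b = "perm x (int i + 1)"
  have "?a \<in> signed_range n" "?b \<in> signed_range n"
    using signed_perms_range[OF perm_in_signed_perms[OF x(1)]] simple_in_signed_range[OF x(2)] by auto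
  moreover have "?a \<noteq> ?b"
    using signed_permsD(1)[OF perm_in_signed_perms[OF x(1)]] by (simp add: inj_eq simple_low_def)
  ultimately show ?thesis
    using that perm_conj[OF x(1,2)] x(3) signed_swap_commute by (metis linorder_neqE)
qed

text \<open>Sign changes are conjugates of generator 0 and all other signed swaps are conjugates of
  generator 1, so it suffices to find an element that carries the pair of the generator to
  \<open>a\<close> and \<open>b\<close>.\<close>

lemma signed_swap_reflection:
  assumes ab: "a \<in> signed_range n" "b \<in> signed_range n" "a \<noteq> b"
  obtains t where "t \<in> reflections G gens" "perm t = signed_swap a b"
proof -
  have n: "0 < n" using ab by (auto simp: signed_range_def)
  then have one: "1 \<in> signed_range n" by (simp add: signed_range_def)
  have "\<exists>i<n. \<exists>f\<in>signed_perms n. f (simple_low i) = a \<and> f (int i + 1) = b"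
  proof (cases "b = - a")
    case True
    have "signed_swap 1 b 1 = b" by (simp add: signed_swap_def)
    moreover from this have "signed_swap 1 b (- 1) = - b"
      using ab signed_swap_minus[of 1 b 1] by (simp add: signed_range_def)
    ultimately show ?thesis
      using True n one ab signed_swap_in_signed_perms[of 1 n b]
      by (intro exI[of _ 0] conjI bexI[of _ "signed_swap 1 b"]) (auto simp: simple_low_def)
  next
    case False
    have two: "Suc 0 < n" "2 \<in> signed_range n" using ab False by (auto simp: signed_range_def)
    \<comment> \<open>\<open>?g\<close> sends 1 to \<open>a\<close>. The second factor sends 2 to
      \<open>?c\<close>, hence on to \<open>b\<close>, and leaves 1 alone because \<open>?c\<close>
      is neither 1 nor \<open>- 1\<close>.\<close>
    let ?g = "signed_swap 1 a"
    let ?c = "?g b"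
    let ?f = "?g \<circ> signed_swap 2 ?c"
    have g: "?g \<in> signed_perms n" using one ab by (intro signed_swap_in_signed_perms)
    have c: "?c \<in> signed_range n" by (rule signed_perms_range[OF g ab(2)])
    have "?g 1 = a" "?g (- 1) = - a"
      using ab signed_swap_minus[of 1 a 1] by (auto simp: signed_swap_def signed_range_def)
    moreover have gg: "?g (?g x) = x" for x
      using ab by (intro signed_swap_involution) (auto simp: signed_range_def)
    ultimately have "?c \<noteq> 1" "?c \<noteq> - 1" using ab(3) False by (metis minus_minus)+
    then have "?f 1 = a" using \<open>?g 1 = a\<close> by (simp add: signed_swap_def[of 2])
    moreover have "?f 2 = b" using gg by (simp add: signed_swap_def[of 2])
    moreover have "?f \<in> signed_perms n" using g c two by (intro signed_perms_comp[OF g] signed_swap_in_signed_perms)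
    ultimately show ?thesis
      using two(1) by (intro exI[of _ 1] conjI bexI[of _ ?f]) (auto simp: simple_low_def)
  qed
  then obtain i f where i: "i < n" "f \<in> signed_perms n" "f (simple_low i) = a" "f (int i + 1) = b"
    by blast
  then obtain x where "x \<in> carrier G" "perm x = f" using perm_surj by blast
  then show ?thesis
    using i perm_conj[of x i] that[of "x \<otimes> s i \<otimes> inv x"] by (auto simp: reflections_def)
qed

lemma gen_reflection: "i < n \<Longrightarrow> s i \<in> reflections G gens"
  unfolding reflections_def by (auto intro!: exI[of _ "\<one>"] exI[of _ "s i"])

section \<open>The Bruhat interval as the set of dominated elements\<close>

text \<open>Since the step raises the length, the reflected pair must be an inversion of
  \<open>v\<close>; otherwise it would be one of \<open>u\<close>, and
  \<open>coxeter_length_swap\<close> would make \<open>v\<close> the shorter element. Then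
  \<open>dominated_down\<close> applies.\<close>

lemma bruhat_step_dominated:
  assumes "bruhat_step G gens u v" "dominated n (perm v)"
  shows "dominated n (perm u)"
proof -
  obtain t where t: "u \<in> carrier G" "v \<in> carrier G" "t \<in> reflections G gens" "v = u \<otimes> t"
    "coxeter_length G gens u < coxeter_length G gens v"
    using assms(1) by (auto simp: bruhat_step_def)
  obtain a b where ab: "a \<in> signed_range n" "b \<in> signed_range n" "a < b" "perm t = signed_swap a b"
    using perm_reflection[OF t(3)] by blast
  have nz: "a \<noteq> 0" "b \<noteq> 0" using ab by (auto simp: signed_range_def)
  have v: "perm v = perm u \<circ> signed_swap a b"
    using t ab perm_mult reflections_carrier by simp
  then have u: "perm u = perm v \<circ> signed_swap a b"
    using signed_swap_involution[OF nz] by (simp add: fun_eq_iff)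
  have "perm v a \<noteq> perm v b"
    using ab(3) signed_permsD(1)[OF perm_in_signed_perms[OF t(2)]] by (simp add: inj_eq)
  moreover have "\<not> perm v a < perm v b"
  proof
    assume "perm v a < perm v b"
    moreover have "perm u b = perm v a" "perm u a = perm v b"
      unfolding u by (simp_all add: signed_swap_def)
    ultimately have "perm u b < perm u a" by simp
    then show False using coxeter_length_swap[OF t(1,2) ab(1-3) v] t(5) by simp
  qed
  ultimately have "perm v b < perm v a" by simp
  then show ?thesis
    unfolding u by (intro dominated_down perm_in_signed_perms t(2) assms(2) ab)
qed

lemma bruhat_le_dominated:
  "bruhat_le G gens u v \<Longrightarrow> dominated n (perm v) \<Longrightarrow> dominated n (perm u)"
  unfolding bruhat_le_def
  by (induction rule: converse_rtranclp_induct) (auto intro: bruhat_step_dominated)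

lemma finite_dominated: "finite {f \<in> signed_perms n. dominated n f}"
  using bij_betw_finite[OF window_bij] finite_signed_lists by blast

text \<open>Repeated use of \<open>dominated_up\<close> climbs in Bruhat order. The climb ends
  because only finitely many signed permutations are dominated, so \<open>M\<close> bounds their
  lengths.\<close>

lemma bruhat_le_top:
  assumes w: "w \<in> carrier G" "\<And>i. i \<in> {1..int n} \<Longrightarrow> perm w i = i - int n - 1"
    and g: "g \<in> carrier G" "dominated n (perm g)"
  shows "bruhat_le G gens g w"
proof -
  let ?l = "\<lambda>f. signed_length (window n f)"
  let ?D = "{f \<in> signed_perms n. dominated n f}"
  define M where "M = Max (?l ` ?D)"
  have M: "?l f \<le> M" if "f \<in> ?D" for f
    unfolding M_def using finite_dominated that by (intro Max_ge) auto
  show ?thesis using g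
  proof (induction "M - coxeter_length G gens g" arbitrary: g rule: less_induct)
    case less
    note f = perm_in_signed_perms[OF less.prems(1)]
    show ?case
    proof (cases "\<exists>i\<in>{1..int n}. perm g i \<noteq> i - int n - 1")
      case True
      obtain a b where ab: "a \<in> signed_range n" "b \<in> signed_range n" "a < b" "perm g a < perm g b"
        "dominated n (perm g \<circ> signed_swap a b)"
        using dominated_up[OF f less.prems(2) True] by blast
      obtain t where t: "t \<in> reflections G gens" "perm t = signed_swap a b"
        using signed_swap_reflection[OF ab(1,2)] ab(3) by auto
      let ?h = "g \<otimes> t"
      have h: "?h \<in> carrier G" "perm ?h = perm g \<circ> signed_swap a b"
        using less.prems t reflections_carrier by (simp_all add: perm_mult)
      have "perm g = perm ?h \<circ> signed_swap a b"
        using ab signed_swap_involution[of a b] by (simp add: h fun_eq_iff signed_range_def)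
      moreover have "perm ?h b < perm ?h a" using ab by (simp add: h signed_swap_def)
      ultimately have len: "coxeter_length G gens g < coxeter_length G gens ?h"
        using ab by (intro coxeter_length_swap[OF h(1) less.prems(1) ab(1-3)])
      have dom: "dominated n (perm ?h)" using ab(5) h by simp
      then have "coxeter_length G gens ?h \<le> M"
        using M perm_in_signed_perms[OF h(1)] coxeter_length_perm[OF h(1)] by simp
      then have "bruhat_le G gens ?h w"
        using len by (intro less.hyps h(1) dom) simp
      moreover have "bruhat_step G gens g ?h"
        using less.prems h t len by (auto simp: bruhat_step_def)
      ultimately show ?thesis
        unfolding bruhat_le_def by (rule converse_rtranclp_into_rtranclp[rotated])
    next
      case False
      then have "perm g = perm w"
        using w by (intro signed_perms_eqI[OF f perm_in_signed_perms]) auto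
      then have "g = w" using less.prems(1) w(1) by (intro perm_eqD)
      then show ?thesis by (simp add: bruhat_le_def)
    qed
  qed
qed

text \<open>Dropping the last letter of a reduced word is a downward Bruhat step.\<close>

lemma bruhat_le_one:
  assumes "g \<in> carrier G"
  shows "bruhat_le G gens \<one> g"
  using assms
proof (induction "coxeter_length G gens g" arbitrary: g rule: less_induct)
  case less
  obtain xs where xs: "xs \<in> lists {..<n}" "word_perm xs = perm g"
    "length xs = coxeter_length G gens g"
    using signed_perm_word[OF perm_in_signed_perms[OF less.prems]] coxeter_length_perm[OF less.prems]
    by metis
  then have g: "g = word_val xs" using less.prems by (intro perm_eqD) (auto simp: perm_word_val)
  show ?case
  proof (cases xs rule: rev_cases)
    case Nil
    then show ?thesis using g by (simp add: bruhat_le_def)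
  next
    case (snoc ys i)
    then have l: "ys \<in> lists {..<n}" "i < n" using xs by auto
    let ?h = "word_val ys"
    have h: "?h \<in> carrier G" using l by blast
    have "coxeter_length G gens ?h \<le> length ys"
      using coxeter_length_perm[OF h] signed_length_word[OF l(1)] perm_word_val[OF l(1)] by simp
    then have len: "coxeter_length G gens ?h < coxeter_length G gens g" using xs(3) snoc by simp
    have "g = ?h \<otimes> s i" using g snoc l by (simp add: word_val_append)
    then have "bruhat_step G gens ?h g"
      using h less.prems gen_reflection[OF l(2)] len by (auto simp: bruhat_step_def)
    then show ?thesis
      using less.hyps[OF len h] unfolding bruhat_le_def by (rule rtranclp.rtrancl_into_rtrancl[rotated])
  qed
qed

text \<open>The parabolic generators are \<open>gens - {s 0}\<close> as a set of elements, so no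
  other index may name the same element as 0.\<close>

lemma gen_neq_gen_0:
  assumes "0 < i" "i < n"
  shows "s i \<noteq> s 0"
proof
  assume "s i = s 0"
  then have "simple_swap i = simple_swap 0" using assms perm_gen[of i] perm_gen[of 0] by simp
  then have "simple_swap i (- 1) = simple_swap 0 (- 1)" by simp
  then show False using assms by (auto simp: simple_swap_def signed_swap_def simple_low_def split: if_splits)
qed

section \<open>The maximal minimal coset representative\<close>

abbreviation min_reps :: "'a set" where
  "min_reps \<equiv> min_left_coset_reps G gens (gens - {s 0})"

text \<open>A descent at a positive \<open>i\<close> would let \<open>s i\<close> shorten
  \<open>x\<close> within its own coset.\<close>

lemma min_reps_increasing:
  assumes "x \<in> min_reps" "1 \<le> i" "i < n"
  shows "perm x (int i) < perm x (int i + 1)"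
proof (rule ccontr)
  have x: "x \<in> carrier G" using assms(1) by (simp add: min_left_coset_reps_def)
  assume "\<not> perm x (int i) < perm x (int i + 1)"
  moreover have "perm x (int i) \<noteq> perm x (int i + 1)"
    using signed_permsD(1)[OF perm_in_signed_perms[OF x]] by (simp add: inj_eq)
  ultimately have "perm x (int i + 1) < perm x (int i)" by simp
  moreover have "perm (x \<otimes> s i) = perm x \<circ> signed_swap (int i) (int i + 1)"
    using x assms by (simp add: perm_mult perm_gen simple_swap_def simple_low_def)
  moreover have "int i \<in> signed_range n" "int i + 1 \<in> signed_range n"
    using assms by (auto simp: signed_range_def)
  ultimately have "coxeter_length G gens (x \<otimes> s i) < coxeter_length G gens x"
    using x assms by (intro coxeter_length_swap[of x _ "int i" "int i + 1"]) auto
  moreover have "s i \<in> gens - {s 0}" using gen_neq_gen_0[of i] assms by auto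
  then have "x \<otimes> s i \<in> x <# generate G (gens - {s 0})"
    unfolding l_coset_def by (auto intro: generate.incl)
  ultimately show False using assms(1) by (force simp: min_left_coset_reps_def)
qed

text \<open>The window increases by at least 1 per step and starts at \<open>- n\<close> or
  above.\<close>

lemma min_reps_dominated:
  assumes "x \<in> min_reps"
  shows "dominated n (perm x)"
  unfolding dominated_def
proof
  fix i assume i: "i \<in> {1..int n}"
  have f: "perm x \<in> signed_perms n"
    using assms by (intro perm_in_signed_perms) (simp add: min_left_coset_reps_def)
  have "1 \<in> signed_range n" using i by (simp add: signed_range_def)
  then have "- int n \<le> perm x 1" using signed_perms_range[OF f, of 1] by (simp add: signed_range_def abs_le_iff)
  then show "i - int n - 1 \<le> perm x i"
    using increasing_bounds(1)[of n "perm x" "nat i", OF min_reps_increasing[OF assms]] i by (auto simp: Suc_le_eq nat_le_iff)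
qed

lemma parabolic_positive:
  assumes "h \<in> generate G (gens - {s 0})"
  shows "h \<in> carrier G \<and> (\<forall>x>0. perm h x > 0)"
  using assms
proof (induction rule: generate.induct)
  case one
  then show ?case by (simp add: perm_one)
next
  case (incl h)
  then obtain i where "i < n" "h = s i" "i \<noteq> 0" by force
  then show ?case by (auto simp: perm_gen simple_swap_def signed_swap_def simple_low_def)
next
  case (inv h)
  then obtain i where "i < n" "h = s i" "i \<noteq> 0" by force
  then show ?case by (auto simp: perm_gen simple_swap_def signed_swap_def simple_low_def)
next
  case (eng g h)
  then show ?case by (simp add: perm_mult)
qed

text \<open>Rather than comparing lengths over the coset, a shortest element \<open>y\<close> of it
  is shown to be \<open>w\<close>: its window increases, is dominated, and ends below 0, which
  forces every entry.\<close>

lemma top_in_min_reps: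
  assumes w: "w \<in> carrier G" "\<And>i. i \<in> {1..int n} \<Longrightarrow> perm w i = i - int n - 1"
  shows "w \<in> min_reps"
proof -
  let ?H = "generate G (gens - {s 0})"
  have sub: "subgroup ?H G" by (rule generate_is_subgroup) auto
  have "\<exists>y\<in>w <# ?H. \<forall>z\<in>w <# ?H. coxeter_length G gens y \<le> coxeter_length G gens z"
  proof -
    have "w \<in> w <# ?H" using w(1) unfolding l_coset_def by (force intro: generate.one)
    then show ?thesis
      using ex_has_least_nat[of "\<lambda>y. y \<in> w <# ?H" w "coxeter_length G gens"] by blast
  qed
  then obtain y where y: "y \<in> w <# ?H" "\<And>z. z \<in> w <# ?H \<Longrightarrow> coxeter_length G gens y \<le> coxeter_length G gens z"
    by blast
  then obtain h where h: "h \<in> ?H" "y = w \<otimes> h" by (auto simp: l_coset_def)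
  then have hc: "h \<in> carrier G" using parabolic_positive by blast
  then have yc: "y \<in> carrier G" using h w by simp
  have "y <# ?H = w <# ?H" using l_repr_independence[OF y(1) w(1) sub] by simp
  then have mem: "y \<in> min_reps" using y yc by (simp add: min_left_coset_reps_def)
  note f = perm_in_signed_perms[OF yc]
  have "perm y i = i - int n - 1" if i: "i \<in> {1..int n}" for i
  proof -
    have n: "int n \<in> signed_range n" using i by (auto simp: signed_range_def)
    have "perm h (int n) \<in> signed_range n" using signed_perms_range[OF perm_in_signed_perms[OF hc] n] .
    \<comment> \<open>The parabolic factor keeps positive arguments positive, and \<open>w\<close>
      is negative on \<open>{1..n}\<close>, so the last entry of \<open>y\<close> is
      negative.\<close>
    moreover have "perm h (int n) > 0" using parabolic_positive[OF h(1)] i by simp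
    ultimately have "perm h (int n) \<in> {1..int n}" by (auto simp: signed_range_def)
    then have "perm y (int n) < 0" using h hc w by (simp add: perm_mult)
    then have "perm y i \<le> i - int n - 1"
      using increasing_bounds(2)[of n "perm y" "nat i", OF min_reps_increasing[OF mem]] i by (auto simp: Suc_le_eq nat_le_iff)
    moreover have "i - int n - 1 \<le> perm y i"
      using min_reps_dominated[OF mem] i by (simp add: dominated_def)
    ultimately show ?thesis by simp
  qed
  then have "perm y = perm w"
    using w by (intro signed_perms_eqI[OF f perm_in_signed_perms]) auto
  then show ?thesis using perm_eqD[OF yc w(1)] mem by simp
qed

lemma top_exists:
  obtains w where "w \<in> carrier G" "\<And>i. i \<in> {1..int n} \<Longrightarrow> perm w i = i - int n - 1"
proof -
  define f where "f x = (if x \<in> {1..int n} then x - int n - 1 else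
    if - x \<in> {1..int n} then x + int n + 1 else x)" for x
  have "f \<in> signed_perms n" by (auto simp: signed_perms_def f_def inj_def)
  then obtain w where "w \<in> carrier G" "perm w = f" using perm_surj by blast
  then show ?thesis using that by (simp add: f_def)
qed

text \<open>The explicit element lies above every minimal representative and is one itself, so a
  maximal one must coincide with it.\<close>

lemma bruhat_maximal_top:
  assumes "bruhat_maximal_in G gens min_reps w" "i \<in> {1..int n}"
  shows "perm w i = i - int n - 1"
proof -
  obtain v where v: "v \<in> carrier G" "\<And>i. i \<in> {1..int n} \<Longrightarrow> perm v i = i - int n - 1"
    using top_exists by blast
  have w: "w \<in> min_reps" "w \<in> carrier G"
    using assms(1) by (auto simp: bruhat_maximal_in_def min_left_coset_reps_def)
  then have "bruhat_le G gens w v" using min_reps_dominated by (intro bruhat_le_top v)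
  then have "v = w" using assms(1) top_in_min_reps[OF v] by (auto simp: bruhat_maximal_in_def)
  then show ?thesis using v assms(2) by blast
qed

lemma bruhat_interval_top:
  assumes "w \<in> carrier G" "\<And>i. i \<in> {1..int n} \<Longrightarrow> perm w i = i - int n - 1"
  shows "bruhat_interval G gens \<one> w = {g \<in> carrier G. dominated n (perm g)}"
proof -
  have "dominated n (perm w)" using assms by (simp add: dominated_def)
  then show ?thesis
    using bruhat_le_one bruhat_le_top[OF assms] bruhat_le_dominated
    by (auto simp: bruhat_interval_def)
qed

lemma poincare_top:
  fixes q :: "'c::comm_ring_1"
  assumes "w \<in> carrier G" "\<And>i. i \<in> {1..int n} \<Longrightarrow> perm w i = i - int n - 1"
  shows "poincare G gens \<one> w q = (\<Sum>xs\<in>signed_lists {1..int n}. q ^ signed_length xs)"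
proof -
  let ?D = "{g \<in> carrier G. dominated n (perm g)}"
  have inj: "inj_on perm ?D" by (rule inj_onI) (auto intro: perm_eqD)
  have img: "perm ` ?D = {f \<in> signed_perms n. dominated n f}"
    by (auto simp: perm_in_signed_perms) (metis (mono_tags, lifting) image_eqI mem_Collect_eq perm_surj)
  have "bij_betw (\<lambda>g. window n (perm g)) ?D (signed_lists {1..int n})"
    using bij_betw_trans[OF bij_betw_imageI[OF inj img] window_bij] by (simp add: o_def)
  then have "(\<Sum>xs\<in>signed_lists {1..int n}. q ^ signed_length xs) =
      (\<Sum>g\<in>?D. q ^ signed_length (window n (perm g)))"
    by (rule sum.reindex_bij_betw[symmetric])
  also have "\<dots> = (\<Sum>g\<in>?D. q ^ coxeter_length G gens g)"
    by (intro sum.cong) (auto simp: coxeter_length_perm)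
  also have "?D = bruhat_interval G gens \<one> w" using assms by (intro bruhat_interval_top[symmetric])
  finally show ?thesis by (simp add: poincare_def)
qed

end

text \<open>A nonzero \<open>q\<close> in a field gives meaning to \<open>1 / q\<close>; taking
  \<open>q\<close> to be the variable of a field of rational functions gives the formal
  identity.\<close>

theorem theorem3p4:
  fixes G :: "('a, 'm) monoid_scheme" and s :: "nat \<Rightarrow> 'a" and n :: nat
    and S :: "'a set" and w :: 'a and q :: "'b::field"
  assumes "n \<ge> 1"
    and "coxeter_system G {..<n} s type_B_matrix"
    and "S = s ` {..<n}"
    and "bruhat_maximal_in G S (min_left_coset_reps G S (S - {s 0})) w"
    and "q \<noteq> 0"
  shows "poincare G S \<one>\<^bsub>G\<^esub> w q =
    q ^ ((n + 1) choose 2) * (\<Sum>i=0..n. q_stirling (1 / q) (n + 1) (i + 1) * q_fact q i)"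
proof -
  interpret group G using assms(2) by (simp add: coxeter_system_def)
  interpret type_B G s n
    using assms(2) by unfold_locales (auto simp: coxeter_system_def)
  have max: "bruhat_maximal_in G gens min_reps w" using assms(3,4) by simp
  then have "w \<in> carrier G" by (simp add: bruhat_maximal_in_def min_left_coset_reps_def)
  then show ?thesis
    using poincare_top[OF _ bruhat_maximal_top[OF max]] sum_signed_lists[OF assms(5)] assms(3) by metis
qed

end
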